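(* Let $n,k,t$ be positive integers such that $3\le t\le k\le n$ and $n\ge (t+1)(k-t+1)$. If $\mathcal{A}\subseteq\binom{[n]}{k}$ and $\mathcal{B}\subseteq\binom{[n]}{k}$ are cross-$t$-intersecting, then \[ |\mathcal{A}||\mathcal{B}|\le \binom{n-t}{k-t}^2 . \] Moreover, equality holds if and only if $\mathcal{A}=\mathcal{B}$ is a maximum $t$-intersecting subfamily of $\binom{[n]}{k}$.
   Context: $[n]=\{1,\dots,n\}$ and $\binom{[n]}{k}$ denotes the family of all $k$-element subsets of $[n]$. Two families $\mathcal{A},\mathcal{B}$ of subsets of $[n]$ are cross-$t$-intersecting if $|A\cap B|\ge t$ for all $A\in\mathcal{A}$, $B\in\mathcal{B}$. A family $\mathcal{F}$ is $t$-intersecting if $|A\cap B|\ge t$ for all $A,B\in\mathcal{F}$; a maximum $t$-intersecting subfamily of $\binom{[n]}{k}$ is one of largest possible size among all $t$-intersecting subfamilies of $\binom{[n]}{k}$. *)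

theory Defs
  imports "HOL-Library.Ramsey"
begin

definition cross_t_intersecting :: "nat \<Rightarrow> 'a set set \<Rightarrow> 'a set set \<Rightarrow> bool" where
  "cross_t_intersecting t \<A> \<B> \<longleftrightarrow> (\<forall>A\<in>\<A>. \<forall>B\<in>\<B>. card (A \<inter> B) \<ge> t)"

(* A and B may coincide here, so every member of the family has at least t elements. *)
definition t_intersecting :: "nat \<Rightarrow> 'a set set \<Rightarrow> bool" where
  "t_intersecting t \<F> \<longleftrightarrow> (\<forall>A\<in>\<F>. \<forall>B\<in>\<F>. card (A \<inter> B) \<ge> t)"

(* "Maximum" refers to cardinality, not to inclusion. *)
definition maximum_t_intersecting :: "nat \<Rightarrow> 'a set set \<Rightarrow> 'a set set \<Rightarrow> bool" where
  "maximum_t_intersecting t \<U> \<F> \<longleftrightarrow>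
     \<F> \<subseteq> \<U> \<and> t_intersecting t \<F> \<and>
     (\<forall>\<G>. \<G> \<subseteq> \<U> \<and> t_intersecting t \<G> \<longrightarrow> card \<G> \<le> card \<F>)"

end

theory Submission
  imports Defs Complex_Main "HOL-Combinatorics.Transposition"
begin

text \<open>
  Take a pair of maximal product and shift it. With V the small sets meeting all of \<open>\<A>\<close> in at least
  t points and U the small sets meeting all of V in at least t points, let l be the largest element
  that is ever essential, so that both families are determined by their traces on [l]. Essential
  occurrences of l come in critical pairs of sizes i and j with i + j = l + t. Removing l from the
  critical sets of one family and deleting their partners from the other one multiplies the product
  by (1 + r x)(1 - y), where x and y are the proportions of the families above the critical sets and
  r is a ratio of binomial coefficients, essentially at least t. By maximality this is at most 1, as
  is its mirror image, whereas shiftedness forces x \<open>\<le>\<close> i/l and y \<open>\<le>\<close> j/l. These inequalities are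
  incompatible unless i = j = t, giving a star, or i = j = t + 1, giving the family of all sets with
  at least t + 1 elements in [t + 2], which for \<open>n \<ge> (t + 1)(k - t + 1)\<close> is no larger than a star.
  Undoing the shifts one at a time, connectivity of Kneser-type graphs shows that both families
  were equal (and of the same kind) from the start.
\<close>

text \<open>A trace on [l] may have fewer than \<open>k\<close> elements, so the argument runs in
  families of sets of size at most \<open>k\<close> that are closed under the polarity
  \<open>perp\<close>; only their level \<open>k\<close> enters the product. A product leaves the
  ratio of the two family sizes free, so a single exchange merely bounds one density by the other.
  Chaining it with its mirror image eliminates both densities and leaves a relation between t, a, b,
  k - t and n - k, where t + a \<le> t + b are the critical sizes. The hypothesis on n says
  precisely that n - k \<ge> t * (k - t) + 1. With it the relation is contradictory whenever 1 \<le>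
  a, 2 \<le> b and t + a \<le> b * (t - 1). For t \<ge> 3 the last condition fails only at t = 3, a
  = b = 2, which is why sets one level above the critical ones are counted there; for t = 2 it would
  fail for every a = b. Uniqueness needs no separate argument: the structure is established for
  every pair of maximal product, so the value of the maximum and the equality case come from one
  result.\<close>

definition small_sets :: "nat \<Rightarrow> nat \<Rightarrow> nat set set" where
  "small_sets n k = {E. E \<subseteq> {1..n} \<and> card E \<le> k}"

text \<open>The polarity of the relation "meet in at least t points" on \<open>small_sets\<close>; a
  pair with \<open>U = perp n k t V\<close> and \<open>V = perp n k t U\<close> is closed for this
  Galois connection.\<close>

definition perp :: "nat \<Rightarrow> nat \<Rightarrow> nat \<Rightarrow> nat set set \<Rightarrow> nat set set" where
  "perp n k t \<X> = {E \<in> small_sets n k. \<forall>G\<in>\<X>. t \<le> card (E \<inter> G)}"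

definition shifted :: "nat set set \<Rightarrow> bool" where
  "shifted \<X> \<longleftrightarrow> (\<forall>E\<in>\<X>. \<forall>i j. 1 \<le> i \<longrightarrow> i < j \<longrightarrow> j \<in> E \<longrightarrow> i \<notin> E \<longrightarrow> insert i (E - {j}) \<in> \<X>)"

definition level :: "nat \<Rightarrow> nat set set \<Rightarrow> nat set set" where
  "level k \<X> = {F \<in> \<X>. card F = k}"

definition max_cross_pair :: "nat \<Rightarrow> nat \<Rightarrow> nat \<Rightarrow> nat set set \<Rightarrow> nat set set \<Rightarrow> bool" where
  "max_cross_pair n k t \<A> \<B> \<longleftrightarrow>
     \<A> \<subseteq> nsets {1..n} k \<and> \<B> \<subseteq> nsets {1..n} k \<and> cross_t_intersecting t \<A> \<B> \<and>
     (\<forall>\<A>' \<B>'. \<A>' \<subseteq> nsets {1..n} k \<longrightarrow> \<B>' \<subseteq> nsets {1..n} k \<longrightarrow> cross_t_intersecting t \<A>' \<B>' \<longrightarrow>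
        card \<A>' * card \<B>' \<le> card \<A> * card \<B>)"

definition star :: "nat \<Rightarrow> nat \<Rightarrow> nat set \<Rightarrow> nat set set" where
  "star n k T = {F \<in> nsets {1..n} k. T \<subseteq> F}"

text \<open>The case r = 1 of the families in the Complete Intersection Theorem of Ahlswede and
  Khachatrian: at least t + r elements in a fixed set of size t + 2r.\<close>

definition frankl :: "nat \<Rightarrow> nat \<Rightarrow> nat \<Rightarrow> nat set \<Rightarrow> nat set set" where
  "frankl n k t S = {F \<in> nsets {1..n} k. t + 1 \<le> card (F \<inter> S)}"

section \<open>Stars and Frankl families\<close>

lemma nsets_nat_iff: "F \<in> nsets {1..n} k \<longleftrightarrow> F \<subseteq> {1..n::nat} \<and> card F = k"
  by (auto simp: nsets_def intro: finite_subset)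

lemma finite_nsets_nat: "finite (nsets {1..n::nat} k)"
  by (rule finite_subset[of _ "Pow {1..n}"]) (auto simp: nsets_def)

lemma finite_star: "finite (star n k T)" and finite_frankl: "finite (frankl n k t S)"
  unfolding star_def frankl_def using finite_nsets_nat by simp_all

lemma card_nsets_trace:
  assumes S: "S \<subseteq> {1..n::nat}" and E: "E \<subseteq> S" and "card E \<le> k"
  shows "card {F \<in> nsets {1..n} k. F \<inter> S = E} = (n - card S) choose (k - card E)"
proof -
  have fS: "finite S" "finite E" using S E finite_subset[OF S] finite_subset[OF E] by auto
  have "bij_betw (\<lambda>D. D \<union> E) (nsets ({1..n} - S) (k - card E)) {F \<in> nsets {1..n} k. F \<inter> S = E}"
  proof (rule bij_betw_byWitness[where f' = "\<lambda>F. F - S"])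
    show "\<forall>D\<in>nsets ({1..n} - S) (k - card E). D \<union> E - S = D"
      using E by (auto simp: nsets_def)
    show "\<forall>F\<in>{F \<in> nsets {1..n} k. F \<inter> S = E}. F - S \<union> E = F" by auto
    show "(\<lambda>D. D \<union> E) ` nsets ({1..n} - S) (k - card E) \<subseteq> {F \<in> nsets {1..n} k. F \<inter> S = E}"
    proof clarify
      fix D assume D: "D \<in> nsets ({1..n} - S) (k - card E)"
      then have "D \<inter> E = {}" "finite D" "card D = k - card E" using E by (auto simp: nsets_def)
      then have "card (D \<union> E) = k" using fS assms(3) by (simp add: card_Un_disjoint)
      then show "D \<union> E \<in> nsets {1..n} k \<and> (D \<union> E) \<inter> S = E"
        using D S E fS by (auto simp: nsets_def)
    qed
    show "(\<lambda>F. F - S) ` {F \<in> nsets {1..n} k. F \<inter> S = E} \<subseteq> nsets ({1..n} - S) (k - card E)"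
    proof clarify
      fix F assume F: "F \<in> nsets {1..n} k" "E = F \<inter> S"
      then have "card (F - S) = k - card (F \<inter> S)"
        using fS by (simp add: card_Diff_subset_Int nsets_def)
      then show "F - S \<in> nsets ({1..n} - S) (k - card (F \<inter> S))"
        using F by (auto simp: nsets_def)
    qed
  qed
  then have "card {F \<in> nsets {1..n} k. F \<inter> S = E} = card (nsets ({1..n} - S) (k - card E))"
    by (rule bij_betw_same_card[symmetric])
  also have "\<dots> = (n - card S) choose (k - card E)"
    using S fS by (simp add: card_nsets card_Diff_subset)
  finally show ?thesis .
qed

lemma card_nsets_traces:
  assumes S: "S \<subseteq> {1..n::nat}" and X: "\<And>E. E \<in> \<X> \<Longrightarrow> E \<subseteq> S \<and> card E = i" and "i \<le> k"
  shows "card {F \<in> nsets {1..n} k. F \<inter> S \<in> \<X>} = card \<X> * ((n - card S) choose (k - i))"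
proof -
  have fX: "finite \<X>" by (rule finite_subset[of _ "Pow S"]) (use X finite_subset[OF S] in auto)
  have "{F \<in> nsets {1..n} k. F \<inter> S \<in> \<X>} = (\<Union>E\<in>\<X>. {F \<in> nsets {1..n} k. F \<inter> S = E})" by auto
  also have "card \<dots> = (\<Sum>E\<in>\<X>. card {F \<in> nsets {1..n} k. F \<inter> S = E})"
    by (rule card_UN_disjoint) (use fX finite_nsets_nat in auto)
  also have "\<dots> = (\<Sum>E\<in>\<X>. (n - card S) choose (k - i))"
    by (rule sum.cong[OF refl]) (use card_nsets_trace[OF S] X assms(3) in fastforce)
  finally show ?thesis by simp
qed

lemma card_star:
  assumes "T \<subseteq> {1..n}" "card T = t" "t \<le> k"
  shows "card (star n k T) = (n - t) choose (k - t)"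
proof -
  have "star n k T = {F \<in> nsets {1..n} k. F \<inter> T = T}" by (auto simp: star_def)
  then show ?thesis using card_nsets_trace[of T n T k] assms by simp
qed

lemma cross_star:
  assumes "card T = t" shows "cross_t_intersecting t (star n k T) (star n k T)"
  unfolding cross_t_intersecting_def star_def
proof (intro ballI)
  fix A B assume "A \<in> {F \<in> nsets {1..n} k. T \<subseteq> F}" "B \<in> {F \<in> nsets {1..n} k. T \<subseteq> F}"
  then have "T \<subseteq> A \<inter> B" "finite (A \<inter> B)" by (auto simp: nsets_def)
  then show "t \<le> card (A \<inter> B)" using assms card_mono by blast
qed

lemma card_Int_frankl:
  assumes "card S = t + 2" "t + 1 \<le> card (A \<inter> S)" "t + 1 \<le> card (B \<inter> S)" "finite A"
  shows "t \<le> card (A \<inter> B)"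
proof -
  have fS: "finite S" using assms(1) card.infinite by fastforce
  have "card (A \<inter> S) + card (B \<inter> S) = card ((A \<inter> S) \<union> (B \<inter> S)) + card ((A \<inter> S) \<inter> (B \<inter> S))"
    using fS by (intro card_Un_Int) auto
  moreover have "card ((A \<inter> S) \<union> (B \<inter> S)) \<le> card S" by (rule card_mono) (use fS in auto)
  moreover have "card ((A \<inter> S) \<inter> (B \<inter> S)) \<le> card (A \<inter> B)" by (rule card_mono) (use assms in auto)
  ultimately show ?thesis using assms by linarith
qed

lemma cross_frankl:
  assumes "card S = t + 2" shows "cross_t_intersecting t (frankl n k t S) (frankl n k t S)"
  unfolding cross_t_intersecting_def frankl_def
  using card_Int_frankl[OF assms] by (auto simp: nsets_def)

lemma binomial_step:
  assumes "s \<le> m" shows "Suc s * (m choose Suc s) = (m - s) * (m choose s)"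
  by (metis binomial_absorb_comp binomial_absorption)

text \<open>The two families are compared off their intersection. A member of the first missing some
  d in \<open>T\<close> has trace \<open>S - {d}\<close> on \<open>S\<close>, so at most t traces of
  size t + 1 occur; conversely all sets with trace exactly \<open>T\<close> lie only in the star.
  The hypothesis on n gives \<open>?m - s \<ge> t * Suc s\<close>, with equality at the threshold,
  and this is the ratio of binomial coefficients required.\<close>

lemma frankl_le_star:
  assumes "t < k" "S \<subseteq> {1..n}" "card S = t + 2" "n \<ge> (t + 1) * (k - t + 1)"
  shows "card (frankl n k t S) \<le> (n - t) choose (k - t)"
proof -
  have fS: "finite S" using assms finite_subset by blast
  obtain T where T: "T \<subseteq> S" "card T = t" using assms(3) by (metis le_add1 obtain_subset_with_card_n)
  let ?F = "frankl n k t S" and ?St = "star n k T"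
  let ?m = "n - (t + 2)"
  define X where "X = (\<lambda>d. S - {d}) ` T"
  have TS: "T \<subseteq> {1..n}" using T assms by auto
  have cX: "card X \<le> t" using T card_image_le[of T] fS finite_subset X_def by metis
  have Xp: "E \<subseteq> S \<and> card E = t + 1" if "E \<in> X" for E
  proof -
    obtain d where "E = S - {d}" "d \<in> S" using \<open>E \<in> X\<close> T by (auto simp: X_def)
    then show ?thesis using assms(3) by simp
  qed
  have sub: "?F - ?St \<subseteq> {F \<in> nsets {1..n} k. F \<inter> S \<in> X}"
  proof
    fix F assume F: "F \<in> ?F - ?St"
    then obtain d where d: "d \<in> T" "d \<notin> F" by (auto simp: star_def frankl_def)
    have "F \<inter> S = S - {d}"
      using F d T fS assms(3) by (intro card_seteq) (auto simp: frankl_def)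
    then show "F \<in> {F \<in> nsets {1..n} k. F \<inter> S \<in> X}" using F d by (auto simp: frankl_def X_def)
  qed
  have "card (?F - ?St) \<le> card {F \<in> nsets {1..n} k. F \<inter> S \<in> X}"
    by (rule card_mono) (use sub finite_nsets_nat in auto)
  also have "\<dots> = card X * (?m choose (k - (t + 1)))"
    using card_nsets_traces[of S n X "t + 1" k] assms Xp by simp
  also have "\<dots> \<le> t * (?m choose (k - (t + 1)))" using cX by simp
  also have "\<dots> \<le> ?m choose (k - t)"
  proof -
    define s where "s = k - (t + 1)"
    have k: "k = s + t + 1" using assms(1) s_def by simp
    have "(t + 1) * (s + 2) \<le> n" using assms(4) k by simp
    then have le: "t * Suc s + s \<le> ?m" by (simp add: algebra_simps)
    have "Suc s * (t * (?m choose s)) = (t * Suc s) * (?m choose s)" by (simp only: mult_ac)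
    also have "\<dots> \<le> (?m - s) * (?m choose s)" using le by (intro mult_le_mono1) linarith
    also have "\<dots> = Suc s * (?m choose Suc s)" using binomial_step[of s ?m] le by simp
    finally have "t * (?m choose s) \<le> ?m choose Suc s" by (simp only: Suc_mult_le_cancel1)
    then show ?thesis using k by simp
  qed
  also have "\<dots> = card {F \<in> nsets {1..n} k. F \<inter> S = T}"
    using card_nsets_trace[of S n T k] assms T by simp
  also have "\<dots> \<le> card (?St - ?F)"
    by (rule card_mono) (use T finite_nsets_nat in \<open>auto simp: star_def frankl_def intro: finite_subset\<close>)
  finally have "card (?F - ?St) \<le> card (?St - ?F)" .
  moreover have "card ?F = card (?F \<inter> ?St) + card (?F - ?St)"
    by (rule card_Int_Diff[OF finite_frankl])
  moreover have "card ?St = card (?St \<inter> ?F) + card (?St - ?F)"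
    by (rule card_Int_Diff[OF finite_star])
  ultimately show ?thesis using card_star[OF TS T(2), of k] assms(1) by (simp add: Int_commute)
qed

section \<open>Shifted dual pairs\<close>

lemma cross_commute: "cross_t_intersecting t \<A> \<B> \<longleftrightarrow> cross_t_intersecting t \<B> \<A>"
  unfolding cross_t_intersecting_def by (metis Int_commute)

lemma card_swap: "finite E \<Longrightarrow> j \<in> E \<Longrightarrow> i \<notin> E \<Longrightarrow> card (insert i (E - {j})) = card E"
  by (metis Diff_iff card.remove card_insert_disjoint finite_Diff)

lemma perp_cross: "E \<in> perp n k t \<X> \<Longrightarrow> G \<in> \<X> \<Longrightarrow> t \<le> card (E \<inter> G)"
  by (simp add: perp_def)

lemma perp_antimono: "\<X> \<subseteq> \<Y> \<Longrightarrow> perp n k t \<Y> \<subseteq> perp n k t \<X>"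
  by (auto simp: perp_def)

lemma subset_perp_perp: "\<X> \<subseteq> small_sets n k \<Longrightarrow> \<X> \<subseteq> perp n k t (perp n k t \<X>)"
  by (auto simp: perp_def Int_commute)

lemma perp_perp_perp:
  assumes "\<X> \<subseteq> small_sets n k"
  shows "perp n k t (perp n k t (perp n k t \<X>)) = perp n k t \<X>"
proof (rule subset_antisym)
  show "perp n k t (perp n k t (perp n k t \<X>)) \<subseteq> perp n k t \<X>"
    by (rule perp_antimono[OF subset_perp_perp[OF assms]])
  show "perp n k t \<X> \<subseteq> perp n k t (perp n k t (perp n k t \<X>))"
    by (rule subset_perp_perp) (auto simp: perp_def)
qed

text \<open>The shifted set can lose a point against \<open>G\<close> only if
  \<open>j \<in> G\<close> and \<open>i \<notin> G\<close>. Then \<open>E\<close> is tested against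
  the shift of \<open>G\<close> instead, which is in the family too: as \<open>i \<notin> E\<close>,
  that intersection avoids both i and j and survives in the shifted set.\<close>

lemma shifted_perp:
  assumes sh: "shifted \<X>" and fin: "\<And>G. G \<in> \<X> \<Longrightarrow> finite G"
  shows "shifted (perp n k t \<X>)"
  unfolding shifted_def
proof (intro ballI allI impI)
  fix E i j assume E: "E \<in> perp n k t \<X>" and ij: "1 \<le> i" "i < j" "j \<in> E" "i \<notin> E"
  have fE: "finite E" and En: "E \<subseteq> {1..n}" "card E \<le> k"
    using E by (auto simp: perp_def small_sets_def intro: finite_subset)
  let ?E = "insert i (E - {j})"
  have "card ?E = card E" using fE ij by (intro card_swap)
  then have "?E \<in> small_sets n k" using ij En by (auto simp: small_sets_def)
  moreover have "t \<le> card (?E \<inter> G)" if G: "G \<in> \<X>" for G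
  proof (cases "j \<in> G \<and> i \<notin> G")
    case False
    have EG: "t \<le> card (E \<inter> G)" using E G by (rule perp_cross)
    show ?thesis
    proof (cases "j \<in> G")
      case True
      then have "?E \<inter> G = insert i (E \<inter> G - {j})" using False by auto
      moreover have "card (insert i (E \<inter> G - {j})) = card (E \<inter> G)"
        using fE ij True by (intro card_swap) auto
      ultimately show ?thesis using EG by simp
    next
      case False
      then have "E \<inter> G \<subseteq> ?E \<inter> G" by auto
      then show ?thesis using EG fE card_mono[of "?E \<inter> G" "E \<inter> G"] by simp
    qed
  next
    case True
    let ?G = "insert i (G - {j})"
    have "?G \<in> \<X>" using sh G ij True by (auto simp: shifted_def)
    then have "t \<le> card (E \<inter> ?G)" using E by (auto intro: perp_cross)
    also have "E \<inter> ?G \<subseteq> ?E \<inter> G" using ij True by auto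
    then have "card (E \<inter> ?G) \<le> card (?E \<inter> G)" using fE by (intro card_mono) auto
    finally show ?thesis .
  qed
  ultimately show "?E \<in> perp n k t \<X>" by (simp add: perp_def)
qed

text \<open>This is what the overview calls l being essential for some member.\<close>

definition pivot :: "nat set set \<Rightarrow> nat \<Rightarrow> bool" where
  "pivot \<X> l \<longleftrightarrow> (\<exists>E\<in>\<X>. l \<in> E \<and> E - {l} \<notin> \<X>)"

definition critical :: "nat set set \<Rightarrow> nat \<Rightarrow> nat \<Rightarrow> nat set set" where
  "critical \<X> l i = {E \<in> \<X>. E \<subseteq> {1..l} \<and> l \<in> E \<and> E - {l} \<notin> \<X> \<and> card E = i}"

text \<open>The families consist of sets of size at most k, not exactly k: they play the role of generating
  families, and every member of U meets every member of V in at least t points.\<close>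

locale dual_pair =
  fixes n k t :: nat and U V :: "nat set set"
  assumes t3: "3 \<le> t" and tk: "t \<le> k" and n_ge: "n \<ge> (t + 1) * (k - t + 1)"
    and U_eq: "U = perp n k t V" and V_eq: "V = perp n k t U"
    and sh_U: "shifted U" and sh_V: "shifted V"
    and maximal: "max_cross_pair n k t (level k U) (level k V)"
begin

lemma dual: "dual_pair n k t V U"
proof
  show "max_cross_pair n k t (level k V) (level k U)"
    using maximal unfolding max_cross_pair_def
    by (auto simp: cross_commute mult.commute)
qed (fact t3 tk n_ge U_eq V_eq sh_U sh_V)+

text \<open>For i + j = l + t with j \<le> k this yields l + k < n + i, which keeps the coefficients
  \<open>(n - l) choose (k - i)\<close> positive.\<close>

lemma n_ge_2k: "n + t \<ge> 2 * k + 1"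
proof -
  obtain s where k: "k = t + s" using tk le_Suc_ex by blast
  have "t * s + t + s + 1 \<le> n" using n_ge k by (simp add: algebra_simps)
  moreover have "s \<le> t * s" using mult_le_mono1[of 1 t s] t3 by linarith
  ultimately show ?thesis using k by linarith
qed

lemma kn: "k \<le> n" using n_ge_2k tk by linarith

lemma small: "E \<in> U \<Longrightarrow> E \<subseteq> {1..n} \<and> card E \<le> k \<and> finite E"
  by (subst (asm) U_eq) (auto simp: perp_def small_sets_def intro: finite_subset)

lemma cross: "E \<in> U \<Longrightarrow> G \<in> V \<Longrightarrow> t \<le> card (E \<inter> G)"
  by (subst (asm) U_eq) (rule perp_cross)

lemma upward:
  assumes "E \<in> U" "E \<subseteq> E'" "E' \<subseteq> {1..n}" "card E' \<le> k" shows "E' \<in> U"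
proof -
  have "t \<le> card (E' \<inter> G)" if "G \<in> V" for G
  proof -
    have "card (E \<inter> G) \<le> card (E' \<inter> G)"
      using assms finite_subset[OF assms(3)] by (intro card_mono) auto
    then show ?thesis using cross[OF assms(1) that] by simp
  qed
  then show ?thesis using assms by (subst U_eq) (simp add: perp_def small_sets_def)
qed

lemma shift_U: "E \<in> U \<Longrightarrow> 1 \<le> i \<Longrightarrow> i < j \<Longrightarrow> j \<in> E \<Longrightarrow> i \<notin> E \<Longrightarrow> insert i (E - {j}) \<in> U"
  using sh_U by (auto simp: shifted_def)

lemma level_subset: "level k U \<subseteq> nsets {1..n} k"
  using small by (auto simp: level_def nsets_def)

lemma finite_level: "finite (level k U)"
  using finite_subset[OF level_subset finite_nsets_nat] .

lemma trace_subset_level: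
  assumes "\<X> \<subseteq> U"
  shows "{F \<in> nsets {1..n} k. F \<inter> S \<in> \<X>} \<subseteq> level k U"
proof
  fix F assume F: "F \<in> {F \<in> nsets {1..n} k. F \<inter> S \<in> \<X>}"
  then have "F \<inter> S \<in> U" "F \<subseteq> {1..n}" "card F = k" using assms nsets_nat_iff[of F n k] by auto
  then show "F \<in> level k U" using upward[of "F \<inter> S" F] by (simp add: level_def)
qed

lemma level_pos: "0 < card (level k U)" "0 < card (level k V)"
proof -
  let ?S = "star n k {1..t}"
  have "?S \<subseteq> nsets {1..n} k" by (auto simp: star_def)
  moreover have "cross_t_intersecting t ?S ?S" by (rule cross_star) simp
  ultimately have "card ?S * card ?S \<le> card (level k U) * card (level k V)"
    using maximal unfolding max_cross_pair_def by blast
  moreover have "card ?S > 0" using card_star[of "{1..t}" n t k] tk kn by auto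
  ultimately have "0 < card (level k U) * card (level k V)"
    by (metis less_le_trans nat_0_less_mult_iff)
  then show "0 < card (level k U)" "0 < card (level k V)" by simp_all
qed

lemma U_nonempty: "U \<noteq> {}" and V_nonempty: "V \<noteq> {}"
  using level_pos by (auto simp: level_def)

text \<open>If some \<open>m < l\<close> were outside both sets, replacing \<open>l\<close> by
  \<open>m\<close> in \<open>E\<close> would stay in \<open>U\<close> by shiftedness but meet
  \<open>G\<close> only in \<open>E \<inter> G - {l}\<close>. So the two sets cover [l] while
  sharing exactly t points, which is the source of i + j = l + t.\<close>

lemma tight:
  assumes E: "E \<in> U" and G: "G \<in> V" and lt: "card (E \<inter> G - {l}) < t"
  shows "l \<in> E" "l \<in> G" "card (E \<inter> G) = t" "E - {l} \<notin> U" "G - {l} \<notin> V" "{1..l} \<subseteq> E \<union> G"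
proof -
  have fE: "finite E" using E small by auto
  have ge: "t \<le> card (E \<inter> G)" using E G by (rule cross)
  have l: "l \<in> E \<inter> G" using ge lt by (cases "l \<in> E \<inter> G") auto
  then show "l \<in> E" "l \<in> G" by auto
  have "card (E \<inter> G - {l}) = card (E \<inter> G) - 1" using l fE by simp
  then show eq: "card (E \<inter> G) = t" using ge lt by linarith
  have Elem: "(E - {l}) \<inter> G = E \<inter> G - {l}" "E \<inter> (G - {l}) = E \<inter> G - {l}" by auto
  show "E - {l} \<notin> U" using cross[OF _ G, of "E - {l}"] lt Elem by auto
  show "G - {l} \<notin> V" using cross[OF E, of "G - {l}"] lt Elem by auto
  show "{1..l} \<subseteq> E \<union> G"
  proof (rule ccontr)
    assume "\<not> {1..l} \<subseteq> E \<union> G"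
    then obtain m where "m \<in> {1..l}" and m: "m \<notin> E" "m \<notin> G" by blast
    then have m: "1 \<le> m" "m \<le> l" "m \<notin> E" "m \<notin> G" by simp_all
    then have "m < l" using l by (cases "m = l") auto
    then have "insert m (E - {l}) \<in> U" using shift_U E m l by auto
    then have "t \<le> card (insert m (E - {l}) \<inter> G)" using G by (rule cross)
    moreover have "insert m (E - {l}) \<inter> G = E \<inter> G - {l}" using m by auto
    ultimately show False using lt by simp
  qed
qed

lemma partner:
  assumes E: "E \<in> U" "E - {l} \<notin> U"
  obtains G where "G \<in> V" "card (E \<inter> G - {l}) < t"
proof -
  have "E - {l} \<in> small_sets n k" using small[OF E(1)] card_Diff1_le[of E l]
    by (auto simp: small_sets_def)
  then obtain G where "G \<in> V" "\<not> t \<le> card ((E - {l}) \<inter> G)"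
    using E(2) by (subst (asm) U_eq) (auto simp: perp_def)
  moreover have "(E - {l}) \<inter> G = E \<inter> G - {l}" by auto
  ultimately show ?thesis using that by auto
qed

text \<open>Elements above \<open>l\<close> are deleted from the top one at a time; each deletion
  stays in \<open>U\<close> because the element deleted is not a pivot.\<close>

lemma trace_in:
  assumes "E \<in> U" "\<And>m. l < m \<Longrightarrow> \<not> pivot U m"
  shows "E \<inter> {1..l} \<in> U"
proof (cases "l \<le> n")
  case True
  then show ?thesis
  proof (rule inc_induct)
    have "E \<inter> {1..n} = E" using small[OF assms(1)] by auto
    then show "E \<inter> {1..n} \<in> U" using assms(1) by simp
  next
    fix m assume m: "l \<le> m" "E \<inter> {1..Suc m} \<in> U"
    show "E \<inter> {1..m} \<in> U"
    proof (cases "Suc m \<in> E")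
      case True
      have "E \<inter> {1..Suc m} - {Suc m} = E \<inter> {1..m}" by auto
      then show ?thesis using assms(2)[of "Suc m"] m True unfolding pivot_def by fastforce
    next
      case False
      then have "E \<inter> {1..Suc m} = E \<inter> {1..m}" by (auto simp: le_Suc_eq)
      then show ?thesis using m by simp
    qed
  qed
next
  case False
  then have "E \<inter> {1..l} = E" using small[OF assms(1)] by fastforce
  then show ?thesis using assms by simp
qed

end

section \<open>Critical sets\<close>

context dual_pair begin

text \<open>By \<open>tight\<close>, the partner of a set for which \<open>l\<close> is essential is
  itself such a set on the other side.\<close>

lemma pivot_dual: "pivot U l \<Longrightarrow> pivot V l"
  unfolding pivot_def using partner tight by (metis)

text \<open>Without pivots every element could be deleted, putting the empty set into
  \<open>U\<close>.\<close>

lemma exists_pivot: "\<exists>l. pivot U l"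
proof (rule ccontr)
  assume "\<nexists>l. pivot U l"
  moreover obtain E where E: "E \<in> U" using U_nonempty by blast
  ultimately have "E \<inter> {1..0} \<in> U" using trace_in by blast
  moreover obtain G where "G \<in> V" using V_nonempty by blast
  ultimately show False using cross[of "E \<inter> {1..0}" G] t3 by simp
qed

lemma pivot_le: "pivot U l \<Longrightarrow> l \<le> n"
  unfolding pivot_def using small by fastforce

end

locale pivot_pair = dual_pair +
  fixes l :: nat
  assumes top_U: "\<And>m. l < m \<Longrightarrow> \<not> pivot U m" and top_V: "\<And>m. l < m \<Longrightarrow> \<not> pivot V m"
    and l_le: "l \<le> n"
begin

lemma pivot_pair_dual: "pivot_pair n k t V U l"
  by (rule pivot_pair.intro[OF dual]) (unfold_locales, use top_U top_V l_le in auto)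

lemma trace: "E \<in> U \<Longrightarrow> E \<inter> {1..l} \<in> U"
  using trace_in top_U by blast

lemma trace_V: "E \<in> V \<Longrightarrow> E \<inter> {1..l} \<in> V"
  using dual_pair.trace_in[OF dual] top_V by blast

text \<open>A set with essential \<open>l\<close> and its partner are cut down to [l]; the traces
  are still tight, so their union is [l] and their intersection has t points.\<close>

lemma exists_critical:
  assumes "pivot U l"
  obtains i j where "critical U l i \<noteq> {}" "critical V l j \<noteq> {}" "i + j = l + t"
    "t \<le> i" "t \<le> j" "i \<le> k" "j \<le> k"
proof -
  obtain E where E: "E \<in> U" "l \<in> E" "E - {l} \<notin> U" using assms by (auto simp: pivot_def)
  obtain G where G: "G \<in> V" "card (E \<inter> G - {l}) < t" using partner E by blast
  let ?E = "E \<inter> {1..l}" and ?G = "G \<inter> {1..l}"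
  have EG: "?E \<in> U" "?G \<in> V" using E G trace trace_V by auto
  have "card (?E \<inter> ?G - {l}) \<le> card (E \<inter> G - {l})"
    by (rule card_mono) (use small E in auto)
  then have "card (?E \<inter> ?G - {l}) < t" using G by simp
  note tight = tight[OF EG this]
  have fin: "finite ?E" "finite ?G" by auto
  have "?E \<union> ?G = {1..l}" using tight(6) by blast
  then have sum: "card ?E + card ?G = l + t" using card_Un_Int[OF fin] tight(3) by simp
  have "card (?E \<inter> ?G) \<le> card ?E" "card (?E \<inter> ?G) \<le> card ?G" by (intro card_mono; auto)+
  then have "t \<le> card ?E" "t \<le> card ?G" using tight(3) by simp_all
  moreover have "card ?E \<le> k" "card ?G \<le> k" using small EG dual_pair.small[OF dual] by auto
  moreover have "?E \<in> critical U l (card ?E)" "?G \<in> critical V l (card ?G)"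
    using EG tight by (auto simp: critical_def)
  ultimately show ?thesis using sum that by blast
qed

lemma finite_critical: "finite (critical U l i)"
  by (rule finite_subset[of _ "Pow {1..l}"]) (auto simp: critical_def)

lemma card_traces:
  assumes "\<And>E. E \<in> \<X> \<Longrightarrow> E \<subseteq> {1..l} \<and> card E = i" "i \<le> k"
  shows "card {F \<in> nsets {1..n} k. F \<inter> {1..l} \<in> \<X>} = card \<X> * ((n - l) choose (k - i))"
  using card_nsets_traces[of "{1..l}" n \<X> i k] assms l_le by simp

text \<open>Dropping l from the critical i-sets of U only conflicts with the critical sets of V of the
  complementary size l + t - i; deleting the latter yields a competitor for the maximal pair.\<close>

lemma exchange:
  assumes ij: "i + j = l + t" "i \<le> k" "j \<le> k" "1 \<le> i"
  shows "(card (level k U) + card (critical U l i) * ((n - l) choose (k - (i - 1)))) *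
      (card (level k V) - card (critical V l j) * ((n - l) choose (k - j)))
      \<le> card (level k U) * card (level k V)"
proof -
  interpret d: pivot_pair n k t V U l by (rule pivot_pair_dual)
  define X where "X = (\<lambda>E. E - {l}) ` critical U l i"
  define A1 where "A1 = {F \<in> nsets {1..n} k. F \<inter> {1..l} \<in> X}"
  define B1 where "B1 = {F \<in> nsets {1..n} k. F \<inter> {1..l} \<in> critical V l j}"
  have inj: "inj_on (\<lambda>E. E - {l}) (critical U l i)"
    unfolding inj_on_def critical_def by blast
  have X: "E \<subseteq> {1..l} \<and> card E = i - 1 \<and> E \<notin> U" if "E \<in> X" for E
    using that by (auto simp: X_def critical_def)
  have A1: "card A1 = card (critical U l i) * ((n - l) choose (k - (i - 1)))"
    unfolding A1_def using card_traces[of X "i - 1"] X ij card_image[OF inj]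
    by (simp add: X_def)
  have B1: "card B1 = card (critical V l j) * ((n - l) choose (k - j))"
    unfolding B1_def by (rule card_traces) (use ij in \<open>auto simp: critical_def\<close>)
  have "A1 \<inter> level k U = {}" using X trace by (auto simp: A1_def level_def)
  then have cA: "card (level k U \<union> A1) = card (level k U) + card A1"
    using finite_level finite_subset[OF _ finite_nsets_nat, of A1 n k]
    by (intro card_Un_disjoint) (auto simp: A1_def)
  have "B1 \<subseteq> level k V" unfolding B1_def
    by (rule d.trace_subset_level) (auto simp: critical_def)
  then have cB: "card (level k V - B1) = card (level k V) - card B1"
    by (intro card_Diff_subset) (use finite_subset d.finite_level in auto)
  have "cross_t_intersecting t (level k U \<union> A1) (level k V - B1)"
    unfolding cross_t_intersecting_def
  proof (intro ballI)
    fix F G assume F: "F \<in> level k U \<union> A1" and G: "G \<in> level k V - B1"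
    then have GV: "G \<in> V" and fG: "finite G" and Gk: "card G = k" and Gn: "G \<subseteq> {1..n}"
      using d.small by (auto simp: level_def)
    show "t \<le> card (F \<inter> G)"
    proof (cases "F \<in> U")
      case True
      then show ?thesis using GV by (rule cross)
    next
      case False
      then obtain E where E: "E \<in> critical U l i" "F \<inter> {1..l} = E - {l}"
        using F by (auto simp: level_def A1_def X_def)
      have EU: "E \<in> U" and El: "E \<subseteq> {1..l}" and fE: "finite E"
        using E small by (auto simp: critical_def)
      show ?thesis
      proof (rule ccontr)
        assume "\<not> t \<le> card (F \<inter> G)"
        moreover have "card (E \<inter> G - {l}) \<le> card (F \<inter> G)"
          by (rule card_mono) (use fG E in auto)
        ultimately have lt: "card (E \<inter> G - {l}) < t" by simp
        note tight = tight[OF EU GV this]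
        let ?G = "G \<inter> {1..l}"
        have GlV: "?G \<in> V" using GV by (rule trace_V)
        \<comment> \<open>\<open>tight\<close> makes \<open>l\<close> essential in \<open>G\<close>,
          not yet in its trace. If the trace without \<open>l\<close> were in \<open>V\<close>, then
          so would be its superset \<open>G - {l}\<close>.\<close>
        have "?G - {l} \<subseteq> G - {l}" by auto
        moreover have "card (G - {l}) \<le> k" using Gk card_Diff1_le[of G l] by simp
        ultimately have "?G - {l} \<notin> V" using tight(5) d.upward[of "?G - {l}" "G - {l}"] Gn by blast
        moreover have "card ?G = j"
        proof -
          have "E \<union> ?G = {1..l}" using tight(6) El by blast
          moreover have "E \<inter> ?G = E \<inter> G" using El by auto
          ultimately show ?thesis
            using card_Un_Int[OF fE, of ?G] tight(3) ij E by (auto simp: critical_def)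
        qed
        moreover have "l \<in> ?G" using tight El by auto
        ultimately have "?G \<in> critical V l j" using GlV by (simp add: critical_def)
        then show False using G d.level_subset by (auto simp: B1_def)
      qed
    qed
  qed
  moreover have "level k U \<union> A1 \<subseteq> nsets {1..n} k" "level k V - B1 \<subseteq> nsets {1..n} k"
    using level_subset d.level_subset by (auto simp: A1_def)
  ultimately have "card (level k U \<union> A1) * card (level k V - B1) \<le> card (level k U) * card (level k V)"
    using maximal unfolding max_cross_pair_def by blast
  then show ?thesis using cA cB A1 B1 by simp
qed

section \<open>Double counting of the gaps of critical sets in [l]\<close>

lemma card_critical_gaps:
  "card (SIGMA E:critical U l i. {1..l} - E) = card (critical U l i) * (l - i)"
proof -
  have "card ({1..l} - E) = l - i" if "E \<in> critical U l i" for E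
    using that card_Diff_subset[of E "{1..l}"] finite_subset[of E "{1..l}"]
    by (auto simp: critical_def)
  then have "(\<Sum>E\<in>critical U l i. card ({1..l} - E)) = card (critical U l i) * (l - i)"
    by (simp del: One_nat_def)
  then show ?thesis using card_SigmaI[of "critical U l i" "\<lambda>E. {1..l} - E"] finite_critical by simp
qed

text \<open>Shifting \<open>l\<close> into a gap m sends (E, m) to (E - {l} + m, m), from which E
  can be recovered. This is the origin of the density bound i / l.\<close>

lemma critical_bound:
  "card (critical U l i) * (l - i) \<le> card {Z \<in> U. Z \<subseteq> {1..l} \<and> l \<notin> Z \<and> card Z = i} * i"
    (is "_ \<le> card ?Z * i")
proof -
  have fZ: "finite ?Z" by (rule finite_subset[of _ "Pow {1..l}"]) auto
  have fin: "finite E" if "E \<subseteq> {1..l}" for E using that finite_subset by auto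
  have "card (critical U l i) * (l - i) = card (SIGMA E:critical U l i. {1..l} - E)"
    by (rule card_critical_gaps[symmetric])
  also have "\<dots> \<le> card (SIGMA Z:?Z. Z)"
  proof (rule card_inj_on_le)
    show "inj_on (\<lambda>(E, m). (insert m (E - {l}), m)) (SIGMA E:critical U l i. {1..l} - E)"
      by (rule inj_on_inverseI[where g = "\<lambda>(Z, m). (insert l (Z - {m}), m)"])
        (auto simp: critical_def)
    show "(\<lambda>(E, m). (insert m (E - {l}), m)) ` (SIGMA E:critical U l i. {1..l} - E) \<subseteq> (SIGMA Z:?Z. Z)"
    proof (rule image_subsetI)
      fix x assume "x \<in> (SIGMA E:critical U l i. {1..l} - E)"
      then obtain E m where x: "x = (E, m)" and E: "E \<in> critical U l i"
        and m: "m \<in> {1..l}" "m \<notin> E" by blast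
      then have ml: "1 \<le> m" "m < l" by (auto simp: critical_def le_less)
      have "insert m (E - {l}) \<in> U" using E m ml shift_U by (auto simp: critical_def)
      moreover have "card (insert m (E - {l})) = i"
        using E m fin card_swap[of E l m] by (simp add: critical_def)
      ultimately show "(\<lambda>(E, m). (insert m (E - {l}), m)) x \<in> (SIGMA Z:?Z. Z)"
        using E m ml x by (auto simp: critical_def)
    qed
    show "finite (SIGMA Z:?Z. Z)" using fZ fin by auto
  qed
  also have "\<dots> = card ?Z * i" using fZ fin by simp
  finally show ?thesis .
qed

text \<open>Here m is added while \<open>l\<close> is kept, so m is one of the i elements of Z other
  than \<open>l\<close>. This counts the sets one level up for the exceptional case t = 3, a = b =
  2.\<close>

lemma critical_bound_above:
  assumes "i < k"
  shows "card (critical U l i) * (l - i) \<le> card {Z \<in> U. Z \<subseteq> {1..l} \<and> l \<in> Z \<and> card Z = i + 1} * i"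
    (is "_ \<le> card ?Z * i")
proof -
  have fZ: "finite ?Z" by (rule finite_subset[of _ "Pow {1..l}"]) auto
  have fin: "finite E" if "E \<subseteq> {1..l}" for E using that finite_subset by auto
  have "card (critical U l i) * (l - i) = card (SIGMA E:critical U l i. {1..l} - E)"
    by (rule card_critical_gaps[symmetric])
  also have "\<dots> \<le> card (SIGMA Z:?Z. Z - {l})"
  proof (rule card_inj_on_le)
    show "inj_on (\<lambda>(E, m). (insert m E, m)) (SIGMA E:critical U l i. {1..l} - E)"
      by (rule inj_on_inverseI[where g = "\<lambda>(Z, m). (Z - {m}, m)"]) auto
    show "(\<lambda>(E, m). (insert m E, m)) ` (SIGMA E:critical U l i. {1..l} - E) \<subseteq> (SIGMA Z:?Z. Z - {l})"
    proof (rule image_subsetI)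
      fix x assume "x \<in> (SIGMA E:critical U l i. {1..l} - E)"
      then obtain E m where x: "x = (E, m)" and E: "E \<in> critical U l i"
        and m: "m \<in> {1..l}" "m \<notin> E" by blast
      have c: "card (insert m E) = i + 1" using E m fin by (auto simp: critical_def)
      have "insert m E \<subseteq> {1..n}" using E m l_le by (auto simp: critical_def)
      then have "insert m E \<in> U" using E c assms upward[of E "insert m E"] by (auto simp: critical_def)
      then show "(\<lambda>(E, m). (insert m E, m)) x \<in> (SIGMA Z:?Z. Z - {l})"
        using E m c x by (auto simp: critical_def)
    qed
    show "finite (SIGMA Z:?Z. Z - {l})" using fZ fin by auto
  qed
  also have "\<dots> = (\<Sum>Z\<in>?Z. card (Z - {l}))" using fZ fin by (intro card_SigmaI) auto
  also have "\<dots> = (\<Sum>Z\<in>?Z. i)" by (rule sum.cong) (auto simp: fin)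
  also have "\<dots> = card ?Z * i" by simp
  finally show ?thesis .
qed

end

section \<open>Densities of critical sets\<close>

text \<open>Here x and y are the proportions of the two families that lie above critical sets of sizes
  t + a and t + b, while rA and rB are the ratios of consecutive binomial coefficients
  n - l choose k - i governing the gain of an exchange; K stands for k - t and N for n - k.\<close>

lemma density_contradiction:
  fixes t a b K N x y rA rB :: real
  assumes t: "3 \<le> t" and a: "1 \<le> a" and ab: "a \<le> b" and bK: "b \<le> K" and b1: "1 < b"
    and N: "t * K + 1 \<le> N" and gap: "t + a \<le> b * (t - 1)"
    and x: "0 < x" "x * (t + a + b) \<le> t + a" and y: "0 < y" "y * (t + a + b) \<le> t + b"
    and rA: "rA * (K - a + 1) = N - b" and rB: "rB * (K - b + 1) = N - a"
    and ex1: "(1 + rA * x) * (1 - y) \<le> 1" and ex2: "(1 + rB * y) * (1 - x) \<le> 1"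
  shows False
proof -
  define L u v where "L = t + a + b" and "u = K - b + 1" and "v = K - a + 1"
  have pos: "0 < u" "u \<le> v" "0 < L" "0 < v" using assms by (auto simp: L_def u_def v_def)
  \<comment> \<open>\<open>P\<close> is \<open>t * K + 1 - b\<close> and \<open>R\<close> is
    \<open>b * t * v - (t + a) * u\<close>, both rewritten with visibly nonnegative terms. They
    bound from below the two factors that remain once x and y are eliminated; the goal is then
    \<open>L * (u * v) < P * R\<close>.\<close>
  define P where "P = t * u + (t - 1) * (b - 1)"
  define R where "R = u * (b * t - t - a) + b * t * (v - u)"
  have btta: "b \<le> b * t - t - a" using gap by (simp add: algebra_simps)
  have "0 < u * (b * t - t - a)" using btta b1 pos by (intro mult_pos_pos) auto
  moreover have "0 \<le> b * t * (v - u)" using b1 t pos by simp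
  ultimately have R: "0 < R" by (simp add: R_def)
  have "t * u + (t - 1) * (b - 1) = t * K + 1 - b" by (simp add: u_def algebra_simps)
  then have P: "P \<le> N - b" using N by (simp add: P_def)
  have "t * v + (t - 1) * (a - 1) = t * K + 1 - a" by (simp add: v_def algebra_simps)
  moreover have "0 \<le> (t - 1) * (a - 1)" using t a by simp
  ultimately have "t * v \<le> N - a" using N by linarith
  then have "b * (t * v) \<le> b * (N - a)" using b1 by (intro mult_left_mono) auto
  then have RN: "R \<le> b * (N - a) - (t + a) * u" by (simp add: R_def algebra_simps)
  have P0: "0 < P" unfolding P_def using t pos b1 by (intro add_pos_pos mult_pos_pos) auto
  have "0 < N - b" using P P0 by linarith
  then have rA0: "0 < rA" using rA pos zero_less_mult_pos2 unfolding v_def by metis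
  have "0 < b * (N - a)" using RN R a t pos
    by (smt (verit, best) mult_pos_pos)
  then have "0 < N - a" using b1 by (simp add: zero_less_mult_iff)
  then have rB0: "0 < rB" using rB pos zero_less_mult_pos2 unfolding u_def by metis
  \<comment> \<open>\<open>ex2\<close> says \<open>rB * y * (1 - x) \<le> x\<close>, and the bound
    on x says \<open>1 - x \<ge> b / L\<close>. Together they bound \<open>rB * y * b\<close> by
    \<open>x * L\<close>, hence by \<open>t + a\<close>.\<close>
  have xb: "b \<le> (1 - x) * L" using x by (simp add: L_def algebra_simps)
  have "rB * y * b \<le> rB * y * ((1 - x) * L)"
    using xb rB0 y by (intro mult_left_mono) auto
  also have "\<dots> = (rB * y * (1 - x)) * L" by simp
  also have "\<dots> \<le> x * L" using ex2 pos by (intro mult_right_mono) (auto simp: algebra_simps)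
  finally have yx: "rB * y * b \<le> x * L" .
  then have yb: "rB * y * b \<le> t + a" using x by (simp add: L_def)
  \<comment> \<open>Multiplying the mirror inequality by \<open>rB * b\<close> makes y occur only
    through \<open>rB * y * b\<close>, which is already bounded: by \<open>x * L\<close> on the
    right and by \<open>t + a\<close> on the left. The common factor x then cancels.\<close>
  have "rA * x * (1 - y) \<le> y" using ex1 by (simp add: algebra_simps)
  then have "(rB * b) * (rA * x * (1 - y)) \<le> (rB * b) * y"
    using rB0 b1 by (intro mult_left_mono) auto
  then have "rA * x * (rB * b - rB * y * b) \<le> x * L" using yx by (simp add: algebra_simps)
  moreover have "rA * x * (rB * b - (t + a)) \<le> rA * x * (rB * b - rB * y * b)"
    using yb rA0 x by (intro mult_left_mono) auto
  ultimately have "x * (rA * (rB * b - (t + a))) \<le> x * L" by (simp add: mult_ac)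
  then have "rA * (rB * b - (t + a)) \<le> L" using x by simp
  then have "rA * (rB * b - (t + a)) * (u * v) \<le> L * (u * v)"
    using pos by (intro mult_right_mono) auto
  moreover have "rA * (rB * b - (t + a)) * (u * v) = (rA * v) * (b * (rB * u) - (t + a) * u)"
    by (simp add: algebra_simps)
  ultimately have "(N - b) * (b * (N - a) - (t + a) * u) \<le> L * (u * v)"
    using rA rB by (simp add: u_def v_def)
  moreover have "P * R \<le> (N - b) * (b * (N - a) - (t + a) * u)"
    using P RN P0 R by (intro mult_mono) auto
  moreover have "L * (u * v) < P * R"
  proof -
    \<comment> \<open>\<open>R\<close> is a combination of \<open>b * t - t - a\<close> and
      \<open>b * t\<close> with weights u and v - u, and L = u-part plus (v - u)-part in the same
      proportions after multiplying by v. So \<open>L * v \<le> t * R\<close> follows from two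
      bounds on \<open>L\<close>; the surplus \<open>(t - 1) * (b - 1)\<close> in \<open>P\<close>
      makes the result strict.\<close>
    have "t * (b * t - t - a) - L = (t + 1) * (b * (t - 1) - (t + a))"
      by (simp add: L_def algebra_simps)
    moreover have "0 \<le> (t + 1) * (b * (t - 1) - (t + a))" using gap t by simp
    ultimately have 1: "L \<le> t * (b * t - t - a)" by linarith
    have "3 * b \<le> t * b" using t b1 by (intro mult_right_mono) auto
    moreover have "3 * (t * b) \<le> t * (t * b)" using t b1 by (intro mult_right_mono) auto
    moreover have "t * 1 \<le> t * b" using t b1 by (intro mult_left_mono) auto
    ultimately have "L \<le> t * (t * b)" using ab b1 unfolding L_def by linarith
    then have 2: "L \<le> t * (b * t)" by (simp add: mult.commute)
    have "L * v = u * L + (v - u) * L" by (simp add: algebra_simps)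
    also have "\<dots> \<le> u * (t * (b * t - t - a)) + (v - u) * (t * (b * t))"
      using 1 2 pos by (intro add_mono mult_left_mono) auto
    also have "\<dots> = t * R" by (simp add: R_def algebra_simps)
    finally have "u * (L * v) \<le> u * (t * R)" using pos by (intro mult_left_mono) auto
    moreover have "0 < (t - 1) * (b - 1) * R" using t b1 R by simp
    ultimately show ?thesis by (simp add: P_def algebra_simps)
  qed
  ultimately show False by linarith
qed

context pivot_pair begin

lemma level_split:
  assumes "\<And>E. E \<in> \<X> \<Longrightarrow> E \<in> U \<and> E \<subseteq> {1..l} \<and> card E = i" "i \<le> k"
    and "\<And>E. E \<in> \<Y> \<Longrightarrow> E \<in> U \<and> E \<subseteq> {1..l} \<and> card E = i'" "i' \<le> k" "i \<noteq> i'"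
  shows "card \<X> * ((n - l) choose (k - i)) + card \<Y> * ((n - l) choose (k - i')) \<le> card (level k U)"
proof -
  let ?f = "\<lambda>\<X>. {F \<in> nsets {1..n} k. F \<inter> {1..l} \<in> \<X>}"
  have fin: "finite (?f \<X>)" for \<X> using finite_nsets_nat by simp
  have "E \<notin> \<Y>" if "E \<in> \<X>" for E using assms(1)[OF that] assms(3)[of E] assms(5) by auto
  then have "?f \<X> \<inter> ?f \<Y> = {}" by blast
  then have "card (?f \<X>) + card (?f \<Y>) = card (?f \<X> \<union> ?f \<Y>)"
    using card_Un_disjoint[OF fin fin] by presburger
  also have "\<dots> \<le> card (level k U)"
  proof (rule card_mono[OF finite_level])
    have "\<X> \<subseteq> U" "\<Y> \<subseteq> U" using assms(1,3) by blast+
    then show "?f \<X> \<union> ?f \<Y> \<subseteq> level k U"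
      using trace_subset_level[of \<X>] trace_subset_level[of \<Y>] by blast
  qed
  finally show ?thesis
    using card_traces[OF _ assms(2), of \<X>] card_traces[OF _ assms(4), of \<Y>] assms(1,3) by simp
qed

lemma level_ge:
  assumes "\<And>E. E \<in> \<X> \<Longrightarrow> E \<in> U \<and> E \<subseteq> {1..l} \<and> card E = i" "i \<le> k"
  shows "card \<X> * ((n - l) choose (k - i)) \<le> card (level k U)"
proof -
  have "\<X> \<subseteq> U" using assms(1) by blast
  then have "card {F \<in> nsets {1..n} k. F \<inter> {1..l} \<in> \<X>} \<le> card (level k U)"
    by (intro card_mono[OF finite_level] trace_subset_level)
  then show ?thesis using card_traces[OF _ assms(2), of \<X>] assms(1) by simp
qed

text \<open>By \<open>card_traces\<close> the numerator counts the k-sets whose trace on [l] is a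
  critical i-set; they all belong to \<open>level k U\<close>, so this is the proportion called x or
  y.\<close>

definition dens :: "nat \<Rightarrow> real" where
  "dens i = real (card (critical U l i) * ((n - l) choose (k - i))) / real (card (level k U))"

lemma binomial_pos:
  assumes "i + j = l + t" "i \<le> k" "t \<le> j" "j \<le> k"
  shows "k - i < n - l" "n - l - (k - i) = n - k - (j - t)" "0 < (n - l) choose (k - i)"
proof -
  have "l + k < n + i" using n_ge_2k assms by linarith
  then show "k - i < n - l" using assms l_le by linarith
  then show "0 < (n - l) choose (k - i)" by simp
  show "n - l - (k - i) = n - k - (j - t)" using assms l_le kn n_ge_2k tk by linarith
qed

lemma dens_pos:
  assumes "critical U l i \<noteq> {}" "i + j = l + t" "i \<le> k" "t \<le> j" "j \<le> k"
  shows "0 < dens i"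
  unfolding dens_def using level_pos binomial_pos[OF assms(2-)] assms(1) finite_critical
  by (simp add: card_gt_0_iff)

text \<open>Adding \<open>card ?P * i\<close> to both sides of \<open>critical_bound\<close>
  compares the critical i-sets with all i-sets counted, and k-sets with different traces are
  different. The second estimate adds the k-sets over the (i + 1)-sets of
  \<open>critical_bound_above\<close>.\<close>

lemma sum_critical_le:
  assumes "i \<le> k"
  shows "card (critical U l i) * l * ((n - l) choose (k - i)) \<le> i * card (level k U)"
    and "i < k \<Longrightarrow> card (critical U l i) * (l * ((n - l) choose (k - i)) +
      (l - i) * ((n - l) choose (k - (i + 1)))) \<le> i * card (level k U)"
proof -
  let ?P = "critical U l i" and ?w = "(n - l) choose (k - i)" and ?w' = "(n - l) choose (k - (i + 1))"
  define Z where "Z = {Z \<in> U. Z \<subseteq> {1..l} \<and> l \<notin> Z \<and> card Z = i}"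
  define Y where "Y = {Z \<in> U. Z \<subseteq> {1..l} \<and> l \<in> Z \<and> card Z = i + 1}"
  have fZ: "finite Z" unfolding Z_def by (rule finite_subset[of _ "Pow {1..l}"]) auto
  have "card (?P \<union> Z) = card ?P + card Z"
    using finite_critical fZ by (intro card_Un_disjoint) (auto simp: critical_def Z_def)
  moreover have PZ: "E \<in> U \<and> E \<subseteq> {1..l} \<and> card E = i" if "E \<in> ?P \<union> Z" for E
    using that unfolding critical_def Z_def by blast
  then have "card (?P \<union> Z) * ?w \<le> card (level k U)" using assms by (rule level_ge)
  ultimately have low: "(card ?P + card Z) * ?w \<le> card (level k U)" by simp
  have Zb: "card ?P * (l - i) \<le> card Z * i" unfolding Z_def by (rule critical_bound)
  have il: "card ?P * l \<le> (card ?P + card Z) * i"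
  proof (cases "i \<le> l")
    case True
    then have "card ?P * l = card ?P * (l - i) + card ?P * i"
      by (metis add_mult_distrib2 le_add_diff_inverse2)
    then show ?thesis using Zb by (simp add: add_mult_distrib)
  next
    \<comment> \<open>Here the truncated \<open>l - i\<close> is 0 and \<open>Zb\<close> is vacuous,
      but \<open>l \<le> i\<close> suffices.\<close>
    case False
    then show ?thesis by (intro mult_mono) auto
  qed
  show "card ?P * l * ?w \<le> i * card (level k U)"
  proof -
    have "card ?P * l * ?w \<le> i * ((card ?P + card Z) * ?w)"
      using mult_le_mono1[OF il, of ?w] by (simp add: mult_ac)
    also have "\<dots> \<le> i * card (level k U)" using low by simp
    finally show ?thesis .
  qed
  assume ik: "i < k"
  have Yb: "card ?P * (l - i) \<le> card Y * i" unfolding Y_def by (rule critical_bound_above[OF ik])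
  have "(card ?P + card Z) * ?w + card Y * ?w' \<le> card (level k U)"
    using level_split[of "?P \<union> Z" i Y "i + 1", OF PZ] \<open>card (?P \<union> Z) = _\<close> ik
    unfolding Y_def by fastforce
  then have "i * ((card ?P + card Z) * ?w + card Y * ?w') \<le> i * card (level k U)" by simp
  moreover have "card ?P * (l * ?w + (l - i) * ?w') \<le> i * ((card ?P + card Z) * ?w + card Y * ?w')"
    using mult_le_mono1[OF il, of ?w] mult_le_mono1[OF Yb, of ?w']
    by (simp add: algebra_simps)
  ultimately show "card ?P * (l * ?w + (l - i) * ?w') \<le> i * card (level k U)" by linarith
qed

lemma dens_le:
  assumes "i \<le> k" shows "dens i * real l \<le> real i"
  using sum_critical_le(1)[OF assms] level_pos(1)
  by (simp add: dens_def divide_le_eq mult_ac flip: of_nat_mult)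

end

text \<open>The case t = 3, a = b = 2, where the bound x \<open>\<le>\<close> 5/7 is too weak and the sets one level above
  the critical ones have to be counted as well.\<close>

lemma density_contradiction_small:
  fixes K N x y r s :: real
  assumes K: "2 \<le> K" and N: "3 * K + 1 \<le> N" and xy: "0 < x" "x \<le> y"
    and x: "x * (7 + 2 * s) \<le> 5" and s: "s * (N - 1) = K - 2" and r: "r * (K - 1) = N - 2"
    and ex: "(1 + r * y) * (1 - x) \<le> 1"
  shows False
proof -
  have "0 < r * (K - 1)" using r N K by linarith
  then have r0: "0 < r" using K by (simp add: zero_less_mult_iff)
  have "0 \<le> s * (N - 1)" using s K by simp
  then have s0: "0 \<le> s" using N K by (simp add: zero_le_mult_iff)
  \<comment> \<open>\<open>ex\<close> gives \<open>r * y * (1 - x) \<le> x\<close>; since x \<le> y,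
    the factor y can be cancelled.\<close>
  have "y * (r * (1 - x)) \<le> y * 1" using ex xy by (simp add: algebra_simps)
  then have "r * (1 - x) \<le> 1" using xy by (simp only: mult_le_cancel_left_pos)
  then have "r * (1 - x) * (K - 1) \<le> 1 * (K - 1)" using K by (intro mult_right_mono) auto
  moreover have "r * (1 - x) * (K - 1) = (N - 2) * (1 - x)"
    unfolding r[symmetric] by (simp add: algebra_simps)
  ultimately have "N - K - 1 \<le> x * (N - 2)" by (simp add: algebra_simps)
  then have "(N - K - 1) * ((7 + 2 * s) * (N - 1)) \<le> x * (N - 2) * ((7 + 2 * s) * (N - 1))"
    using s0 N K by (intro mult_right_mono) auto
  also have "\<dots> = x * (7 + 2 * s) * ((N - 1) * (N - 2))" by (simp add: algebra_simps)
  also have "\<dots> \<le> 5 * ((N - 1) * (N - 2))" using x N K by (intro mult_right_mono) auto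
  also have "(7 + 2 * s) * (N - 1) = 7 * (N - 1) + 2 * (K - 2)"
    unfolding s[symmetric] by (simp add: algebra_simps)
  finally have le: "(N - K - 1) * (7 * (N - 1) + 2 * (K - 2)) \<le> 5 * ((N - 1) * (N - 2))" .
  \<comment> \<open>In terms of \<open>K\<close> and the slack \<open>e \<ge> 0\<close> over the
    threshold, the difference of the two sides has only positive coefficients.\<close>
  define e where "e = N - (3 * K + 1)"
  have "N = 3 * K + 1 + e" by (simp add: e_def)
  then have "(N - K - 1) * (7 * (N - 1) + 2 * (K - 2)) - 5 * ((N - 1) * (N - 2))
      = K * K + 7 * (K * e) + 7 * K + e + 2 * (e * e)"
    by (simp add: algebra_simps)
  moreover have "0 < K * K + 7 * (K * e) + 7 * K + e + 2 * (e * e)"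
    using K N by (intro add_pos_nonneg) (auto simp: e_def)
  ultimately show False using le by linarith
qed

section \<open>Shifted maximal pairs\<close>

lemma factors_eq_of_mult_ge:
  fixes a b c d :: nat
  assumes "a \<le> c" "b \<le> d" "c * d \<le> a * b" "0 < a * b" shows "a = c \<and> b = d"
proof -
  have "c * d \<le> a * d" "c * d \<le> c * b"
    using assms(3) mult_le_mono2[OF assms(2), of a] mult_le_mono1[OF assms(1), of b] by linarith+
  moreover have "0 < c" "0 < d" using assms by (auto simp: Suc_le_eq)
  ultimately show ?thesis using assms by simp
qed

text \<open>While E is not an initial segment, an element above \<open>card E\<close> can be
  exchanged for a missing one below; this lowers \<open>\<Sum>E\<close>, so the process
  ends.\<close>

lemma shifted_initial:
  assumes "shifted \<X>" "E \<in> \<X>" "E \<subseteq> {1..n}"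
  shows "{1..card E} \<in> \<X>"
  using assms(2,3)
proof (induction "\<Sum>E" arbitrary: E rule: less_induct)
  case less
  have fE: "finite E" using less.prems finite_subset by auto
  show ?case
  proof (cases "{1..card E} \<subseteq> E")
    case True
    then have "{1..card E} = E" using fE by (intro card_seteq) auto
    then show ?thesis using less.prems by simp
  next
    case False
    then obtain i where i: "i \<in> {1..card E}" "i \<notin> E" by blast
    have "\<not> E \<subseteq> {1..card E}"
    proof
      assume "E \<subseteq> {1..card E}"
      then have "E = {1..card E}" by (intro card_seteq) auto
      then show False using i by blast
    qed
    then obtain j where j: "j \<in> E" "j \<notin> {1..card E}" by blast
    have ij: "1 \<le> i" "i < j" using i j less.prems by fastforce+
    let ?E = "insert i (E - {j})"
    have "\<Sum>E = j + \<Sum>(E - {j})" using sum.remove[OF fE j(1)] by simp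
    then have lt: "\<Sum>?E < \<Sum>E" using fE i ij by simp
    moreover have "?E \<in> \<X>" using assms(1) less.prems ij i j by (auto simp: shifted_def)
    moreover have "?E \<subseteq> {1..n}" using less.prems ij j by fastforce
    ultimately have "{1..card ?E} \<in> \<X>" by (rule less.hyps)
    then show ?thesis using card_swap[OF fE j(1) i(2)] by (simp only:)
  qed
qed

context dual_pair begin

lemma card_ge_t: "E \<in> U \<Longrightarrow> t \<le> card E"
proof -
  assume E: "E \<in> U"
  obtain G where "G \<in> V" using V_nonempty by blast
  then have "t \<le> card (E \<inter> G)" using cross E by blast
  also have "\<dots> \<le> card E" using small E by (intro card_mono) auto
  finally show "t \<le> card E" .
qed

text \<open>Pairing \<open>\<X>\<close> with itself gives a competitor at least as large in both
  factors, so maximality leaves no room.\<close>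

lemma level_eqI:
  assumes "\<X> \<subseteq> nsets {1..n} k" "cross_t_intersecting t \<X> \<X>" "level k U \<subseteq> \<X>" "level k V \<subseteq> \<X>"
  shows "level k U = \<X> \<and> level k V = \<X>"
proof -
  have fin: "finite \<X>" using finite_subset[OF assms(1) finite_nsets_nat] .
  have le: "card (level k U) \<le> card \<X>" "card (level k V) \<le> card \<X>"
    using assms fin by (auto intro: card_mono)
  have "card \<X> * card \<X> \<le> card (level k U) * card (level k V)"
    using maximal assms(1,2) unfolding max_cross_pair_def by blast
  moreover have "0 < card (level k U) * card (level k V)" using level_pos by simp
  ultimately have "card (level k U) = card \<X> \<and> card (level k V) = card \<X>"
    using le by (intro factors_eq_of_mult_ge)
  then show ?thesis using assms fin by (simp add: card_subset_eq)
qed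

lemma star_case:
  assumes "{1..t} \<in> U" "{1..t} \<in> V"
  shows "level k U = star n k {1..t} \<and> level k V = star n k {1..t}"
proof (rule level_eqI)
  interpret d: dual_pair n k t V U by (rule dual)
  have sub: "{1..t} \<subseteq> E" if "t \<le> card (E \<inter> {1..t})" for E
    using card_seteq[of "{1..t}" "E \<inter> {1..t}"] that by auto
  show "level k U \<subseteq> star n k {1..t}" "level k V \<subseteq> star n k {1..t}"
    using cross[OF _ assms(2)] d.cross[OF _ assms(1)] sub level_subset d.level_subset
    by (auto simp: star_def level_def subset_iff)
  show "star n k {1..t} \<subseteq> nsets {1..n} k" by (auto simp: star_def)
  show "cross_t_intersecting t (star n k {1..t}) (star n k {1..t})" by (rule cross_star) simp
qed

lemma n_minus_k: "t * (k - t) + 1 \<le> n - k"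
proof -
  obtain s where k: "k = t + s" using tk le_Suc_ex by blast
  have "t * s + t + s + 1 \<le> n" using n_ge k by (simp add: algebra_simps)
  then show ?thesis using k by simp
qed

end

section \<open>Exchange and counting inequalities in terms of densities\<close>

context pivot_pair begin

text \<open>This is \<open>exchange\<close> divided by the maximal product. \<open>r\<close> is the
  ratio of \<open>(n - l) choose (k - (i - 1))\<close> to \<open>(n - l) choose (k - i)\<close>; its
  numerator n - l - (k - i) equals n - k - (j - t) because i + j = l + t.\<close>

lemma exchange_dens:
  assumes ij: "i + j = l + t" "t \<le> i" "t \<le> j" "i \<le> k" "j \<le> k"
    and r: "r * (real (k - i) + 1) = real (n - k - (j - t))"
  shows "(1 + r * dens i) * (1 - pivot_pair.dens n k V l j) \<le> 1"
proof -
  interpret d: pivot_pair n k t V U l by (rule pivot_pair_dual)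
  define w w' wj where "w = (n - l) choose (k - i)" and "w' = (n - l) choose (k - (i - 1))"
    and "wj = (n - l) choose (k - j)"
  define p q where "p = card (critical U l i)" and "q = card (critical V l j)"
  let ?A = "real (card (level k U))" and ?B = "real (card (level k V))"
  have pos: "0 < ?A" "0 < ?B" using level_pos by auto
  have "k - (i - 1) = Suc (k - i)" using ij t3 by simp
  then have "Suc (k - i) * w' = (n - k - (j - t)) * w"
    unfolding w'_def w_def using binomial_step[of "k - i" "n - l"] binomial_pos[of i j] ij by simp
  then have "real (Suc (k - i)) * real w' = real (n - k - (j - t)) * real w"
    by (metis of_nat_mult)
  also have "\<dots> = r * (real (k - i) + 1) * real w" by (simp only: r)
  also have "\<dots> = real (Suc (k - i)) * (r * real w)" by (simp add: algebra_simps)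
  finally have w': "real w' = r * real w" by simp
  have "(card (level k U) + p * w') * (card (level k V) - q * wj) \<le> card (level k U) * card (level k V)"
    using exchange[of i j] ij t3 by (simp add: p_def q_def w'_def wj_def)
  then have "real ((card (level k U) + p * w') * (card (level k V) - q * wj)) \<le> ?A * ?B"
    by (metis of_nat_le_iff of_nat_mult)
  \<comment> \<open>Truncated subtraction is never below the real difference, so passing to the
    reals goes in the right direction.\<close>
  moreover have "(?A + p * w') * (?B - q * wj) \<le> real ((card (level k U) + p * w') * (card (level k V) - q * wj))"
  proof -
    have "?B \<le> real ((card (level k V) - q * wj) + q * wj)" by (intro of_nat_mono) simp
    then have "?B - q * wj \<le> real (card (level k V) - q * wj)" by simp
    then have "(?A + p * w') * (?B - q * wj) \<le> (?A + p * w') * real (card (level k V) - q * wj)"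
      by (intro mult_left_mono) auto
    then show ?thesis by simp
  qed
  ultimately have "(?A + p * w') * (?B - q * wj) / (?A * ?B) \<le> 1"
    using pos by (simp add: divide_le_eq)
  moreover have "(?A + p * w') * (?B - q * wj) / (?A * ?B) = (1 + r * dens i) * (1 - d.dens j)"
    using pos by (simp add: dens_def d.dens_def w' p_def q_def w_def wj_def field_simps)
  ultimately show ?thesis by simp
qed

text \<open>\<open>s\<close> is the ratio of \<open>(n - l) choose (k - (i + 1))\<close> to
  \<open>(n - l) choose (k - i)\<close>. For i = k there is no level above, s is 0 and only
  \<open>dens_le\<close> remains.\<close>

lemma dens_le_above:
  assumes ij: "i + j = l + t" "i \<le> k" "t \<le> j" "j \<le> k"
    and s: "s * (real (n - k - (j - t)) + 1) = real (k - i)"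
  shows "dens i * (real l + real (l - i) * s) \<le> real i"
proof (cases "i = k")
  case True
  then have "s = 0" using s by simp
  then show ?thesis using dens_le ij by simp
next
  case False
  then have ik: "i < k" using ij by simp
  define w w' where "w = (n - l) choose (k - i)" and "w' = (n - l) choose (k - (i + 1))"
  let ?p = "real (card (critical U l i))" and ?A = "real (card (level k U))"
  have "Suc (k - (i + 1)) = k - i" using ik by simp
  moreover have "n - l - (k - (i + 1)) = n - k - (j - t) + 1"
    using binomial_pos(1,2)[of i j] ij ik by linarith
  ultimately have "(k - i) * w = (n - k - (j - t) + 1) * w'"
    unfolding w'_def w_def using binomial_step[of "k - (i + 1)" "n - l"] binomial_pos(1)[of i j] ij
    by simp
  then have "real (k - i) * real w = real (n - k - (j - t) + 1) * real w'"
    by (metis of_nat_mult)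
  then have "(real (n - k - (j - t)) + 1) * (s * real w) = (real (n - k - (j - t)) + 1) * real w'"
    by (simp add: s[symmetric] algebra_simps)
  then have w': "real w' = s * real w" by (simp add: add_nonneg_eq_0_iff)
  have "real (card (critical U l i) * (l * w + (l - i) * w')) \<le> real (i * card (level k U))"
    using sum_critical_le(2)[OF ij(2) ik] unfolding w_def w'_def of_nat_le_iff .
  then have "?p * w * (real l + real (l - i) * s) \<le> real i * ?A"
    unfolding of_nat_mult of_nat_add w' by (simp add: algebra_simps)
  then show ?thesis using level_pos by (simp add: dens_def w_def divide_le_eq mult_ac)
qed

text \<open>The critical set must be [l] itself. If a member missed some m in [l], then [l] - {m}
  would be in \<open>U\<close> by \<open>upward\<close>, and shifting \<open>l\<close> to m would
  give [l] - {l}, against criticality. So every member contains [l]. This serves the case a = 0,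
  where the opposite critical size is t + b = l.\<close>

lemma dens_full:
  assumes "critical U l l \<noteq> {}" "l \<le> k"
  shows "1 \<le> dens l"
proof -
  obtain E where E: "E \<in> critical U l l" using assms by blast
  then have "E = {1..l}" using card_seteq[of "{1..l}" E] by (auto simp: critical_def)
  then have lU: "{1..l} - {l} \<notin> U" "1 \<le> l" using E by (auto simp: critical_def)
  have "level k U \<subseteq> {F \<in> nsets {1..n} k. F \<inter> {1..l} \<in> critical U l l}"
  proof
    fix F assume F: "F \<in> level k U"
    then have FU: "F \<inter> {1..l} \<in> U" using trace by (auto simp: level_def)
    have "{1..l} \<subseteq> F"
    proof (rule ccontr)
      assume "\<not> {1..l} \<subseteq> F"
      then obtain m where m: "m \<in> {1..l}" "m \<notin> F" by blast
      have "card ({1..l} - {m}) \<le> k" using card_Diff1_le[of "{1..l}" m] assms by simp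
      moreover have "F \<inter> {1..l} \<subseteq> {1..l} - {m}" "{1..l} - {m} \<subseteq> {1..n}" using m l_le by auto
      ultimately have mU: "{1..l} - {m} \<in> U" using upward[OF FU] by blast
      show False
      proof (cases "m = l")
        case False
        then have "insert m ({1..l} - {m} - {l}) \<in> U" using shift_U[OF mU, of m l] m by auto
        moreover have "insert m ({1..l} - {m} - {l}) = {1..l} - {l}" using m False by auto
        ultimately show False using lU by simp
      qed (use mU lU in simp)
    qed
    then have "F \<inter> {1..l} = E" using \<open>E = {1..l}\<close> by auto
    then show "F \<in> {F \<in> nsets {1..n} k. F \<inter> {1..l} \<in> critical U l l}"
      using F E level_subset by auto
  qed
  then have "card (level k U) \<le> card {F \<in> nsets {1..n} k. F \<inter> {1..l} \<in> critical U l l}"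
    by (rule card_mono[rotated]) (simp add: finite_nsets_nat[simplified])
  also have "\<dots> = card (critical U l l) * ((n - l) choose (k - l))"
    using assms by (intro card_traces) (auto simp: critical_def)
  finally show ?thesis using level_pos by (simp add: dens_def flip: of_nat_mult)
qed

end

text \<open>Only the shape is recorded, not maximum size. For k = t, \<open>frankl\<close> would be
  empty, hence the guard \<open>t < k\<close>.\<close>

definition extremal :: "nat \<Rightarrow> nat \<Rightarrow> nat \<Rightarrow> nat set set \<Rightarrow> bool" where
  "extremal n k t \<F> \<longleftrightarrow>
     (\<exists>T. T \<subseteq> {1..n} \<and> card T = t \<and> \<F> = star n k T) \<or>
     (t < k \<and> (\<exists>S. S \<subseteq> {1..n} \<and> card S = t + 2 \<and> \<F> = frankl n k t S))"

section \<open>Structure of shifted maximal pairs\<close>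

context pivot_pair begin

text \<open>If [t] were in \<open>U\<close>, all members of \<open>V\<close> would contain [t], so
  [t] + l would be the only critical set of \<open>V\<close>. Its shift [t] + (t + 1) is a second
  trace carrying equally many k-sets, hence y \<le> 1/2, and this is incompatible with the two
  exchanges since r \<ge> 3.\<close>

lemma initial_notin:
  assumes l: "l = t + 2" and tk': "t < k"
    and ne: "critical U l (t + 1) \<noteq> {}" "critical V l (t + 1) \<noteq> {}"
  shows "{1..t} \<notin> U"
proof
  assume TU: "{1..t} \<in> U"
  interpret d: pivot_pair n k t V U l by (rule pivot_pair_dual)
  have sub: "{1..t} \<subseteq> G" if "G \<in> V" for G
  proof -
    have "t \<le> card ({1..t} \<inter> G)" using cross[OF TU that] .
    then show ?thesis using card_seteq[of "{1..t}" "{1..t} \<inter> G"] by auto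
  qed
  have crit: "G = insert l {1..t}" if "G \<in> critical V l (t + 1)" for G
  proof -
    have "insert l {1..t} \<subseteq> G" "finite G" "card G = t + 1"
      using that sub d.small by (auto simp: critical_def)
    then show ?thesis using l card_seteq[of G "insert l {1..t}"] by simp
  qed
  then have critV: "critical V l (t + 1) = {insert l {1..t}}" using ne(2) by blast
  then have G: "insert l {1..t} \<in> V" by (auto simp: critical_def)
  have "insert (t + 1) (insert l {1..t} - {l}) \<in> V"
    by (rule d.shift_U[OF G]) (use l in auto)
  moreover have "insert l {1..t} - {l} = {1..t}" using l by auto
  ultimately have G': "insert (t + 1) {1..t} \<in> V" by simp
  have "card {insert l {1..t}, insert (t + 1) {1..t}} * ((n - l) choose (k - (t + 1))) \<le> card (level k V)"
    using G G' l tk' by (intro d.level_ge) auto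
  moreover have "insert l {1..t} \<noteq> insert (t + 1) {1..t}"
  proof
    assume "insert l {1..t} = insert (t + 1) {1..t}"
    then have "l \<in> insert (t + 1) {1..t}" by blast
    then show False using l by simp
  qed
  ultimately have "real (2 * ((n - l) choose (k - (t + 1)))) \<le> real (card (level k V))"
    unfolding of_nat_le_iff by simp
  then have y: "d.dens (t + 1) \<le> 1 / 2"
    using d.level_pos critV by (simp add: d.dens_def divide_le_eq)
  define x y r where "x = dens (t + 1)" and "y = d.dens (t + 1)"
    and "r = real (n - k - 1) / (real (k - (t + 1)) + 1)"
  have ij: "(t + 1) + (t + 1) = l + t" using l by simp
  have x0: "0 < x" "0 < y"
    using dens_pos[OF ne(1) ij] d.dens_pos[OF ne(2) ij] tk' by (auto simp: x_def y_def)
  have "r * (real (k - (t + 1)) + 1) = real (n - k - (t + 1 - t))" by (simp add: r_def)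
  then have ex: "(1 + r * x) * (1 - y) \<le> 1" "(1 + r * y) * (1 - x) \<le> 1"
    unfolding x_def y_def using exchange_dens[OF ij] d.exchange_dens[OF ij] tk' by auto
  have "k - t = Suc (k - (t + 1))" using tk' by simp
  have "3 * Suc (k - (t + 1)) \<le> n - k - 1"
  proof -
    have "3 * (k - t) + 1 \<le> n - k" using n_minus_k mult_le_mono1[OF t3, of "k - t"] by linarith
    then have "3 * Suc (k - (t + 1)) + 1 \<le> n - k" by (simp only: \<open>k - t = _\<close>)
    then show ?thesis by simp
  qed
  then have "3 * real (Suc (k - (t + 1))) \<le> real (n - k - 1)"
    by (metis of_nat_le_iff of_nat_mult of_nat_numeral)
  then have r: "3 \<le> r" by (simp add: r_def le_divide_eq)
  have y2: "y \<le> 1 / 2" using y by (simp add: y_def)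
  \<comment> \<open>From y \<le> 1/2 and r \<ge> 3, \<open>e1\<close> gives x \<le> 1/3; then
    \<open>e2\<close> gives 2 y \<le> x while \<open>e1\<close> gives 3 x / 2 \<le> y, impossible
    for positive densities.\<close>
  have e1: "r * x * (1 - y) \<le> y" and e2: "r * y * (1 - x) \<le> x" using ex by (auto simp: algebra_simps)
  have "r * x * (1 / 2) \<le> r * x * (1 - y)" using r x0 y2 by (intro mult_left_mono) auto
  then have "r * x \<le> 1" using e1 y2 by linarith
  moreover have "3 * x \<le> r * x" using r x0 by (intro mult_right_mono) auto
  ultimately have x3: "x \<le> 1 / 3" by linarith
  have "3 * y * (2 / 3) \<le> r * y * (1 - x)" using r x0 x3 by (intro mult_mono) auto
  then have "2 * y \<le> x" using e2 by linarith
  moreover have "3 * x * (1 / 2) \<le> r * x * (1 - y)" using r x0 y2 by (intro mult_mono) auto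
  ultimately show False using e1 x0 by linarith
qed

text \<open>A trace of size t could be shifted down to [t], which \<open>initial_notin\<close>
  forbids on both sides. So every trace on [t + 2] has at least t + 1 points.\<close>

lemma frankl_case:
  assumes l: "l = t + 2" and tk': "t < k"
    and ne: "critical U l (t + 1) \<noteq> {}" "critical V l (t + 1) \<noteq> {}"
  shows "level k U = frankl n k t {1..t + 2} \<and> level k V = frankl n k t {1..t + 2}"
proof (rule level_eqI)
  interpret d: pivot_pair n k t V U l by (rule pivot_pair_dual)
  have T: "{1..t} \<notin> U" "{1..t} \<notin> V"
    using initial_notin[OF assms] d.initial_notin[OF l tk' ne(2,1)] by auto
  have U: "level k U \<subseteq> frankl n k t {1..t + 2}"
    if pp: "pivot_pair n k t U V l" and T: "{1..t} \<notin> U" for U V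
  proof
    fix F assume F: "F \<in> level k U"
    interpret p: pivot_pair n k t U V l by (rule pp)
    have E: "F \<inter> {1..l} \<in> U" using F p.trace by (auto simp: level_def)
    have "{1..card (F \<inter> {1..l})} \<in> U" using shifted_initial[OF p.sh_U E, of l] by auto
    then have "t + 1 \<le> card (F \<inter> {1..l})"
      using p.card_ge_t[OF E] T by (cases "card (F \<inter> {1..l}) = t") auto
    then show "F \<in> frankl n k t {1..t + 2}" using F p.level_subset l by (auto simp: frankl_def)
  qed
  show "level k U \<subseteq> frankl n k t {1..t + 2}" "level k V \<subseteq> frankl n k t {1..t + 2}"
    using U[OF pivot_pair_axioms T(1)] U[OF pivot_pair_dual T(2)] by auto
  show "frankl n k t {1..t + 2} \<subseteq> nsets {1..n} k" by (auto simp: frankl_def)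
  show "cross_t_intersecting t (frankl n k t {1..t + 2}) (frankl n k t {1..t + 2})"
    by (rule cross_frankl) simp
qed

lemma critical_cases:
  assumes l: "l = t + a + b" and ab: "a \<le> b" and bk: "t + b \<le> k"
    and ne: "critical U l (t + a) \<noteq> {}" "critical V l (t + b) \<noteq> {}"
  shows "a = 0 \<and> b = 0 \<or> a = 1 \<and> b = 1"
proof (rule ccontr)
  assume neg: "\<not> (a = 0 \<and> b = 0 \<or> a = 1 \<and> b = 1)"
  interpret d: pivot_pair n k t V U l by (rule pivot_pair_dual)
  define x y K N rA rB where "x = dens (t + a)" and "y = d.dens (t + b)"
    and "K = real (k - t)" and "N = real (n - k)"
    and "rA = (N - b) / (K - a + 1)" and "rB = (N - a) / (K - b + 1)"
  have ij: "(t + a) + (t + b) = l + t" "(t + b) + (t + a) = l + t" using l by auto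
  have ak: "t + a \<le> k" using ab bk by simp
  have x0: "0 < x" "0 < y"
    using dens_pos[OF ne(1) ij(1)] d.dens_pos[OF ne(2) ij(2)] ak bk by (auto simp: x_def y_def)
  have bK: "real b \<le> K" and aK: "real a \<le> real b" using bk ab by (auto simp: K_def)
  have "real (t * (k - t) + 1) \<le> N" unfolding N_def of_nat_le_iff by (rule n_minus_k)
  then have N: "real t * K + 1 \<le> N" by (simp add: K_def)
  have "3 * K \<le> real t * K" using t3 by (intro mult_right_mono) (auto simp: K_def)
  then have N3: "3 * K + 1 \<le> N" using N by linarith
  have kr: "real (k - (t + a)) = K - a" "real (k - (t + b)) = K - b"
    using ak bk by (auto simp: K_def of_nat_diff)
  have bN: "b \<le> n - k" "a \<le> n - k" using N3 bK aK by (auto simp: N_def simp flip: of_nat_le_iff)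
  have nr: "real (n - k - (t + b - t)) = N - b" "real (n - k - (t + a - t)) = N - a"
    using bN by (auto simp: N_def of_nat_diff)
  have rA: "rA * (K - a + 1) = N - b" and rB: "rB * (K - b + 1) = N - a"
    using bK aK by (auto simp: rA_def rB_def)
  have ex1: "(1 + rA * x) * (1 - y) \<le> 1"
    unfolding x_def y_def using ak bk rA
    by (intro exchange_dens[OF ij(1)]) (simp_all only: kr nr le_add1)
  have ex2: "(1 + rB * y) * (1 - x) \<le> 1"
    unfolding x_def y_def using ak bk rB
    by (intro d.exchange_dens[OF ij(2)]) (simp_all only: kr nr le_add1)
  have xle: "x * (real t + a + b) \<le> real t + a" and yle: "y * (real t + a + b) \<le> real t + b"
    using dens_le[OF ak] d.dens_le[OF bk] l by (auto simp: x_def y_def)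
  show False
  proof (cases "a = 0")
    case True
    then have b1: "1 \<le> real b" using neg by simp
    \<comment> \<open>For a = 0 the opposite density is full, so \<open>ex2\<close> becomes
      \<open>(1 + rB) * (1 - x) \<le> 1\<close>. As \<open>1 - x \<ge> b / (t + b)\<close>, this
      forces \<open>rB * b \<le> t\<close>, too small for \<open>N \<ge> t * K + 1\<close>.\<close>
    have "1 \<le> y" using d.dens_full ne(2) l True bk by (simp add: y_def)
    have "0 < N" using N3 bK b1 by linarith
    then have rB0: "0 \<le> rB" using bK True by (simp add: rB_def)
    have xt: "b \<le> (1 - x) * (real t + b)" using xle True by (simp add: algebra_simps)
    have "x * (real t + b) \<le> 1 * (real t + b)" using xle True by simp
    then have x1: "0 \<le> 1 - x" using b1 by (simp only: mult_le_cancel_right) auto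
    have "(1 + rB) * (1 - x) \<le> (1 + rB * y) * (1 - x)"
      using \<open>1 \<le> y\<close> rB0 x1 by (intro mult_right_mono) (auto simp: mult_le_cancel_left1)
    then have "(1 + rB) * (1 - x) \<le> 1" using ex2 by linarith
    then have "(1 + rB) * (1 - x) * (real t + b) \<le> 1 * (real t + b)" by (intro mult_right_mono) auto
    moreover have "(1 + rB) * b \<le> (1 + rB) * ((1 - x) * (real t + b))"
      using xt rB0 by (intro mult_left_mono) auto
    ultimately have "(1 + rB) * b \<le> real t + b" by (simp add: mult.assoc)
    then have "rB * b \<le> t" by (simp add: algebra_simps)
    moreover have "rB * 1 \<le> rB * b" using b1 rB0 by (intro mult_left_mono) auto
    ultimately have "rB \<le> t" by linarith
    then have "rB * (K - b + 1) \<le> real t * (K - b + 1)" using bK by (intro mult_right_mono) auto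
    then have "N \<le> real t * (K - b + 1)" using rB True by simp
    also have "\<dots> \<le> real t * K" using b1 by (intro mult_left_mono) auto
    finally show False using N by simp
  next
    case False
    then have a1: "1 \<le> real a" and b2: "2 \<le> real b" using neg ab by auto
    show False
    proof (cases "t + a \<le> b * (t - 1)")
      case True
      then have "real (t + a) \<le> real (b * (t - 1))" by (simp only: of_nat_le_iff)
      then have "real t + a \<le> b * (real t - 1)" using t3 by (simp add: of_nat_diff)
      then show False
        using density_contradiction[of "real t" "real a" "real b" K N x y rA rB] t3 a1 b2 bK aK N
          x0 xle yle rA rB ex1 ex2 by simp
    next
      case gap: False
      \<comment> \<open>As a \<le> b, the gap condition follows from t \<le> b * (t - 2), which for
        b \<ge> 2 and t \<ge> 3 fails only at b = 2, t = 3; there a = 1 still satisfies it.\<close>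
      have "a = 2 \<and> b = 2 \<and> t = 3"
      proof -
        obtain t' where t': "t = t' + 3" using t3 by (metis add.commute le_Suc_ex)
        have lt: "b * t' + 2 * b < t' + 3 + a" using gap by (simp add: t' algebra_simps)
        have "2 \<le> b" using b2 by simp
        then have "2 * t' \<le> b * t'" by simp
        then have "2 * b < 3 + a" using lt by linarith
        then have "b = 2" using ab \<open>2 \<le> b\<close> by linarith
        then show ?thesis using lt ab False t' by auto
      qed
      then have a2: "a = 2" and b2: "b = 2" and t_eq: "t = 3" by auto
      have l7: "l = 7" using l a2 b2 t_eq by simp
      define s where "s = (K - 2) / (N - 1)"
      have s: "s * (N - 1) = K - 2" using N3 bK b2 by (simp add: s_def)
      have "s * (real (n - k - (t + b - t)) + 1) = real (k - (t + a))"
        unfolding kr nr using s a2 b2 by simp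
      then have xs: "x * (7 + 2 * s) \<le> 5"
        using dens_le_above[OF ij(1) ak _ bk, of s] a2 b2 t_eq l7 by (simp add: x_def)
      have "s * (real (n - k - (t + a - t)) + 1) = real (k - (t + b))"
        unfolding kr nr using s a2 b2 by simp
      then have ys: "y * (7 + 2 * s) \<le> 5"
        using d.dens_le_above[OF ij(2) bk _ ak, of s] a2 b2 t_eq l7 by (simp add: y_def)
      have r: "rA * (K - 1) = N - 2" "rB * (K - 1) = N - 2" using rA rB a2 b2 by simp_all
      have K2: "2 \<le> K" using bK b2 by simp
      show False
      proof (cases "x \<le> y")
        case True
        then show False
          using density_contradiction_small[OF K2 N3 x0(1) True xs s r(2) ex2] by simp
      next
        case False
        then have "y \<le> x" by simp
        then show False
          using density_contradiction_small[OF K2 N3 x0(2) _ ys s r(1) ex1] by simp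
      qed
    qed
  qed
qed

lemma extremal_of_le:
  assumes l: "l = t + a + b" and ab: "a \<le> b" and bk: "t + b \<le> k"
    and ne: "critical U l (t + a) \<noteq> {}" "critical V l (t + b) \<noteq> {}"
  shows "level k U = level k V \<and> extremal n k t (level k U)"
  using critical_cases[OF assms]
proof
  assume "a = 0 \<and> b = 0"
  then have ab0: "a = 0" "b = 0" by auto
  have full: "{1..t} \<in> X" if "critical X l (t + 0) \<noteq> {}" for X
  proof -
    obtain E where "E \<in> X" "E \<subseteq> {1..t}" "card E = t"
      using \<open>critical X l (t + 0) \<noteq> {}\<close> l ab0 by (auto simp: critical_def)
    then show ?thesis using card_seteq[of "{1..t}" E] by auto
  qed
  have "level k U = star n k {1..t} \<and> level k V = star n k {1..t}"
    using star_case full ne ab0 by simp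
  moreover have "{1..t} \<subseteq> {1..n}" "card {1..t} = t" using tk kn by auto
  ultimately show ?thesis unfolding extremal_def by metis
next
  assume "a = 1 \<and> b = 1"
  then have "l = t + 2" "t < k" "critical U l (t + 1) \<noteq> {}" "critical V l (t + 1) \<noteq> {}"
    using assms by auto
  then have "level k U = frankl n k t {1..t + 2} \<and> level k V = frankl n k t {1..t + 2}" "t < k"
    using frankl_case by blast+
  moreover have "{1..t + 2} \<subseteq> {1..n}" using l_le \<open>l = t + 2\<close> by auto
  moreover have "card {1..t + 2} = t + 2" by simp
  ultimately show ?thesis unfolding extremal_def by metis
qed

end

lemma (in dual_pair) level_extremal: "level k U = level k V \<and> extremal n k t (level k U)"
proof -
  interpret d: dual_pair n k t V U by (rule dual)
  have fin: "finite {l. pivot U l}" by (rule finite_subset[of _ "{..n}"]) (use pivot_le in auto)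
  define l where "l = Max {l. pivot U l}"
  have pl: "pivot U l" using Max_in[OF fin] exists_pivot by (auto simp: l_def)
  have top: "\<not> pivot U m" if "l < m" for m using Max_ge[OF fin, of m] that by (auto simp: l_def)
  have topV: "\<not> pivot V m" if "l < m" for m using top[OF that] d.pivot_dual by blast
  interpret p: pivot_pair n k t U V l by unfold_locales (use top topV pivot_le[OF pl] in auto)
  interpret q: pivot_pair n k t V U l by (rule p.pivot_pair_dual)
  obtain i j where ij: "critical U l i \<noteq> {}" "critical V l j \<noteq> {}" "i + j = l + t"
    "t \<le> i" "t \<le> j" "i \<le> k" "j \<le> k" using p.exists_critical[OF pl] .
  define a b where "a = i - t" and "b = j - t"
  have eq: "i = t + a" "j = t + b" "l = t + a + b" "l = t + b + a" using ij by (auto simp: a_def b_def)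
  show ?thesis
  proof (cases "a \<le> b")
    case True
    then show ?thesis using p.extremal_of_le[of a b] ij eq by auto
  next
    case False
    then show ?thesis using q.extremal_of_le[of b a] ij eq by auto
  qed
qed

section \<open>Shifting\<close>

definition swap_set :: "nat \<Rightarrow> nat \<Rightarrow> nat set \<Rightarrow> nat set" where
  "swap_set i j F = transpose i j ` F"

text \<open>The usual compression replacing j by i, as a membership condition: of the pair {F, swap
  of F}, either both are kept, or a single one present is represented by the set containing i. Sets
  fixed by the swap are unaffected.\<close>

definition shift_family :: "nat \<Rightarrow> nat \<Rightarrow> nat set set \<Rightarrow> nat set set" where
  "shift_family i j \<A> = {F. F \<in> \<A> \<and> swap_set i j F \<in> \<A> \<or> i \<in> F \<and> (F \<in> \<A> \<or> swap_set i j F \<in> \<A>)}"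

lemma mem_swap_set: "x \<in> swap_set i j F \<longleftrightarrow> transpose i j x \<in> F"
  by (simp add: swap_set_def in_transpose_image_iff)

lemma swap_swap [simp]: "swap_set i j (swap_set i j F) = F"
  by (auto simp: mem_swap_set)

lemma swap_set_same: "(i \<in> F \<longleftrightarrow> j \<in> F) \<Longrightarrow> swap_set i j F = F"
  by (auto simp: mem_swap_set transpose_def split: if_splits)

lemma swap_set_up: "i \<in> F \<Longrightarrow> j \<notin> F \<Longrightarrow> swap_set i j F = insert j (F - {i})"
  by (auto simp: mem_swap_set transpose_def split: if_splits)

lemma swap_set_down: "j \<in> F \<Longrightarrow> i \<notin> F \<Longrightarrow> swap_set i j F = insert i (F - {j})"
  by (auto simp: mem_swap_set transpose_def split: if_splits)

lemma inj_swap_set: "inj_on (swap_set i j) \<X>"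
  by (rule inj_on_inverseI[where g = "swap_set i j"]) simp

lemma swap_set_Int: "swap_set i j (F \<inter> G) = swap_set i j F \<inter> swap_set i j G"
  by (auto simp: mem_swap_set)

lemma card_swap_set: "card (swap_set i j F) = card F"
  unfolding swap_set_def by (rule card_image) (rule inj_on_subset[OF inj_transpose], simp)

lemma card_swap_Int: "card (swap_set i j F \<inter> swap_set i j G) = card (F \<inter> G)"
  using card_swap_set[of i j "F \<inter> G"] by (simp add: swap_set_Int)

lemma card_swap_Int_left: "card (swap_set i j F \<inter> G) = card (F \<inter> swap_set i j G)"
  using card_swap_Int[of i j F "swap_set i j G"] by simp

lemma swap_set_subset:
  assumes "i \<in> {1..n}" "j \<in> {1..n}" "F \<subseteq> {1..n}" shows "swap_set i j F \<subseteq> {1..n}"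
  using assms by (auto simp: mem_swap_set transpose_def split: if_splits)

lemma swap_nsets:
  assumes "i \<in> {1..n}" "j \<in> {1..n}"
  shows "swap_set i j F \<in> nsets {1..n} k \<longleftrightarrow> F \<in> nsets {1..n} k"
  using swap_set_subset[OF assms, of F] swap_set_subset[OF assms, of "swap_set i j F"]
  unfolding nsets_nat_iff card_swap_set by auto

text \<open>A member \<open>F\<close> avoiding both i and j is its own swap, so the test on
  \<open>\<A>\<close> already forces \<open>j \<in> F\<close> whenever a member is moved.\<close>

definition shift_map :: "nat \<Rightarrow> nat \<Rightarrow> nat set set \<Rightarrow> nat set \<Rightarrow> nat set" where
  "shift_map i j \<A> F = (if i \<notin> F \<and> swap_set i j F \<notin> \<A> then swap_set i j F else F)"

lemma bij_betw_shift_map: "bij_betw (shift_map i j \<A>) \<A> (shift_family i j \<A>)"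
proof (rule bij_betw_imageI)
  show "inj_on (shift_map i j \<A>) \<A>"
  proof (rule inj_onI)
    fix F G assume "F \<in> \<A>" "G \<in> \<A>" "shift_map i j \<A> F = shift_map i j \<A> G"
    then show "F = G" unfolding shift_map_def by (metis swap_swap)
  qed
  show "shift_map i j \<A> ` \<A> = shift_family i j \<A>"
  proof (intro equalityI subsetI)
    fix G assume "G \<in> shift_map i j \<A> ` \<A>"
    then obtain F where F: "F \<in> \<A>" "G = shift_map i j \<A> F" by blast
    show "G \<in> shift_family i j \<A>"
    proof (cases "i \<notin> F \<and> swap_set i j F \<notin> \<A>")
      case True
      then have "j \<in> F" using swap_set_same[of i F j] F by metis
      then have "i \<in> swap_set i j F" by (simp add: mem_swap_set)
      then show ?thesis using F True by (simp add: shift_family_def shift_map_def)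
    next
      case False
      then show ?thesis using F by (auto simp: shift_family_def shift_map_def)
    qed
  next
    fix G assume G: "G \<in> shift_family i j \<A>"
    show "G \<in> shift_map i j \<A> ` \<A>"
    proof (cases "G \<in> \<A>")
      case True
      then have "shift_map i j \<A> G = G" using G by (auto simp: shift_family_def shift_map_def)
      then show ?thesis using True by (metis imageI)
    next
      case False
      then have sw: "i \<in> G" "swap_set i j G \<in> \<A>" using G by (auto simp: shift_family_def)
      then have "j \<notin> G" using False swap_set_same[of i G j] by metis
      then have "i \<notin> swap_set i j G" by (simp add: mem_swap_set)
      then have "shift_map i j \<A> (swap_set i j G) = G" using False by (simp add: shift_map_def)
      then show ?thesis using sw by (metis imageI)
    qed
  qed
qed

lemma card_shift_family: "card (shift_family i j \<A>) = card \<A>"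
  using bij_betw_same_card[OF bij_betw_shift_map] by simp

lemma shift_family_subset:
  assumes "i \<in> {1..n}" "j \<in> {1..n}" "\<A> \<subseteq> nsets {1..n} k"
  shows "shift_family i j \<A> \<subseteq> nsets {1..n} k"
  using assms(3) swap_nsets[OF assms(1,2)] by (auto simp: shift_family_def)

lemma card_Int_swap_le:
  assumes "i \<in> F" "i \<in> G" "j \<notin> F \<or> j \<notin> G" "finite F"
  shows "card (F \<inter> swap_set i j G) \<le> card (F \<inter> G)"
proof (cases "j \<in> G")
  case True
  then show ?thesis using assms swap_set_same[of i G j] by simp
next
  case False
  show ?thesis
  proof (cases "j \<in> F")
    case True
    then have "swap_set i j F = F" using assms by (intro swap_set_same) simp
    then show ?thesis using card_swap_Int_left[of i j F G] by simp
  next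
    case F: False
    have "F \<inter> swap_set i j G \<subseteq> F \<inter> G" using swap_set_up[OF assms(2) False] F by auto
    then show ?thesis using assms by (intro card_mono) auto
  qed
qed

text \<open>If F and G, or both their swaps, come from the original families, nothing changes. In
  the mixed cases both contain i and one of them lacks j, so replacing one set by its swap cannot
  enlarge the intersection, and the swapped configuration was an original pair.\<close>

lemma cross_shift_family:
  assumes cr: "cross_t_intersecting t \<A> \<B>" and fin: "\<And>F. F \<in> \<A> \<union> \<B> \<Longrightarrow> finite F"
  shows "cross_t_intersecting t (shift_family i j \<A>) (shift_family i j \<B>)"
  unfolding cross_t_intersecting_def
proof (intro ballI)
  fix F G assume F: "F \<in> shift_family i j \<A>" and G: "G \<in> shift_family i j \<B>"
  let ?\<sigma> = "swap_set i j"
  have cr': "t \<le> card (F' \<inter> G')" if "F' \<in> \<A>" "G' \<in> \<B>" for F' G'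
    using cr that by (auto simp: cross_t_intersecting_def)
  have fin_swap: "finite (?\<sigma> H) \<longleftrightarrow> finite H" for H
    by (metis finite_imageI swap_set_def swap_swap)
  have fF: "finite F" using F fin fin_swap[of F] by (auto simp: shift_family_def)
  consider "F \<in> \<A>" "G \<in> \<B>" | "?\<sigma> F \<in> \<A>" "?\<sigma> G \<in> \<B>"
    | "F \<in> \<A>" "?\<sigma> F \<notin> \<A>" "G \<notin> \<B>" "?\<sigma> G \<in> \<B>" | "F \<notin> \<A>" "?\<sigma> F \<in> \<A>" "G \<in> \<B>" "?\<sigma> G \<notin> \<B>"
    using F G by (auto simp: shift_family_def)
  then show "t \<le> card (F \<inter> G)"
  proof cases
    case 1
    then show ?thesis by (rule cr')
  next
    case 2
    then show ?thesis using cr' card_swap_Int[of i j F G] by metis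
  next
    case 3
    then have "i \<in> F" "i \<in> G" using F G by (auto simp: shift_family_def)
    moreover have "j \<notin> G" using swap_set_same[of i G j] 3 \<open>i \<in> G\<close> by metis
    ultimately have "card (F \<inter> ?\<sigma> G) \<le> card (F \<inter> G)" using fF by (intro card_Int_swap_le) auto
    then show ?thesis using cr'[OF 3(1,4)] by simp
  next
    case 4
    then have "i \<in> F" "i \<in> G" using F G by (auto simp: shift_family_def)
    moreover have "j \<notin> F" using swap_set_same[of i F j] 4 \<open>i \<in> F\<close> by metis
    ultimately have "card (F \<inter> ?\<sigma> G) \<le> card (F \<inter> G)" using fF by (intro card_Int_swap_le) auto
    then show ?thesis using cr'[OF 4(2,3)] card_swap_Int_left[of i j F G] by simp
  qed
qed

text \<open>The termination measure for repeated shifting.\<close>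

definition weight :: "nat set set \<Rightarrow> nat" where "weight \<A> = (\<Sum>F\<in>\<A>. \<Sum>F)"

lemma weight_shift_family:
  assumes ij: "i < j" and fin: "finite \<A>" "\<And>F. F \<in> \<A> \<Longrightarrow> finite F"
  shows "weight (shift_family i j \<A>) \<le> weight \<A>"
    and "shift_family i j \<A> \<noteq> \<A> \<Longrightarrow> weight (shift_family i j \<A>) < weight \<A>"
proof -
  let ?m = "shift_map i j \<A>"
  have eq: "weight (shift_family i j \<A>) = (\<Sum>F\<in>\<A>. \<Sum>(?m F))"
    unfolding weight_def by (rule sum.reindex_bij_betw[OF bij_betw_shift_map, symmetric])
  have lt: "\<Sum>(?m F) < \<Sum>F" if F: "F \<in> \<A>" "?m F \<noteq> F" for F
  proof -
    have m: "i \<notin> F" "swap_set i j F \<notin> \<A>" "?m F = swap_set i j F"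
      using F by (auto simp: shift_map_def split: if_splits)
    then have j: "j \<in> F" using swap_set_same[of i F j] F by metis
    have "\<Sum>F = j + \<Sum>(F - {j})" using sum.remove[of F j "\<lambda>x. x"] j fin F by simp
    moreover have "\<Sum>(insert i (F - {j})) = i + \<Sum>(F - {j})" using m fin F by simp
    ultimately show ?thesis using m swap_set_down[OF j m(1)] ij by simp
  qed
  have le: "\<Sum>(?m F) \<le> \<Sum>F" if "F \<in> \<A>" for F
    using lt[OF that] by (cases "?m F = F") auto
  then show "weight (shift_family i j \<A>) \<le> weight \<A>"
    unfolding eq unfolding weight_def by (rule sum_mono)
  assume "shift_family i j \<A> \<noteq> \<A>"
  then have "\<exists>F\<in>\<A>. ?m F \<noteq> F"
    using bij_betw_imp_surj_on[OF bij_betw_shift_map, of i j \<A>] by (metis image_cong image_ident)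
  then show "weight (shift_family i j \<A>) < weight \<A>"
    unfolding eq unfolding weight_def using lt le fin by (intro sum_strict_mono_ex1) auto
qed

lemma shifted_of_fixed:
  assumes "\<A> \<subseteq> nsets {1..n} k"
    and "\<And>i j. 1 \<le> i \<Longrightarrow> i < j \<Longrightarrow> j \<le> n \<Longrightarrow> shift_family i j \<A> = \<A>"
  shows "shifted \<A>"
  unfolding shifted_def
proof (intro ballI allI impI)
  fix F i j assume F: "F \<in> \<A>" and ij: "1 \<le> i" "i < j" "j \<in> F" "i \<notin> F"
  have "j \<le> n" using F ij assms(1) nsets_nat_iff[of F n k] by auto
  then have "F \<in> shift_family i j \<A>" using assms(2) ij F by simp
  then have "swap_set i j F \<in> \<A>" using ij by (auto simp: shift_family_def)
  then show "insert i (F - {j}) \<in> \<A>" using swap_set_down ij by simp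
qed

text \<open>A set F in \<open>\<C>\<close> with i in F and swap of F not in \<open>\<C>\<close> comes either from F or from its swap. If F meets
  the swap of H in fewer than t points, then the choices for F in one family and for H in the other
  must agree; the hypothesis that any two such sets have a common neighbour makes the choice global.\<close>

lemma unshift:
  assumes shA: "shift_family i j \<A> = \<C>" and shB: "shift_family i j \<B> = \<C>" and fin: "finite \<C>"
    and cr: "cross_t_intersecting t \<A> \<B>"
    and conn: "\<And>F G. F \<in> \<C> \<Longrightarrow> i \<in> F \<Longrightarrow> swap_set i j F \<notin> \<C> \<Longrightarrow>
        G \<in> \<C> \<Longrightarrow> i \<in> G \<Longrightarrow> swap_set i j G \<notin> \<C> \<Longrightarrow>
        \<exists>H\<in>\<C>. i \<in> H \<and> swap_set i j H \<notin> \<C> \<and>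
          card (F \<inter> swap_set i j H) < t \<and> card (G \<inter> swap_set i j H) < t"
  shows "\<A> = \<B> \<and> (\<A> = \<C> \<or> \<A> = swap_set i j ` \<C>)"
proof -
  let ?\<sigma> = "swap_set i j"
  define M where "M = {F \<in> \<C>. i \<in> F \<and> ?\<sigma> F \<notin> \<C>}"
  have conn': "\<exists>H\<in>M. card (F \<inter> ?\<sigma> H) < t \<and> card (G \<inter> ?\<sigma> H) < t" if "F \<in> M" "G \<in> M" for F G
    using conn[of F G] that by (auto simp: M_def)
  \<comment> \<open>A family with shift \<open>\<C>\<close> is determined outside \<open>M\<close>
    and its swaps; on \<open>M\<close> it makes one binary choice for each F, namely F or its
    swap.\<close>
  have basic: "(F \<in> \<C> - M \<longrightarrow> F \<in> \<X> \<and> ?\<sigma> F \<in> \<X>) \<and> (F \<in> M \<longrightarrow> (F \<in> \<X>) \<noteq> (?\<sigma> F \<in> \<X>))"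
    if sh: "shift_family i j \<X> = \<C>" for F \<X>
  proof -
    have C: "G \<in> \<C> \<longleftrightarrow> G \<in> \<X> \<and> ?\<sigma> G \<in> \<X> \<or> i \<in> G \<and> (G \<in> \<X> \<or> ?\<sigma> G \<in> \<X>)" for G
      unfolding sh[symmetric] shift_family_def by simp
    have i: "i \<in> ?\<sigma> F \<longleftrightarrow> j \<in> F" by (simp add: mem_swap_set)
    have "i \<in> F \<Longrightarrow> j \<in> F \<Longrightarrow> ?\<sigma> F = F" by (simp add: swap_set_same)
    then show ?thesis using C[of F] C[of "?\<sigma> F"] i by (auto simp: M_def)
  qed
  have all: "\<X> = \<C>" if sh: "shift_family i j \<X> = \<C>" and "M \<subseteq> \<X>" for \<X>
  proof -
    have "\<C> \<subseteq> \<X>" using basic[OF sh] that(2) by blast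
    moreover have "card \<X> = card \<C>" using card_shift_family[of i j \<X>] sh by simp
    moreover have "finite \<X>" using bij_betw_finite[OF bij_betw_shift_map[of i j \<X>]] sh fin by simp
    ultimately show ?thesis using card_subset_eq by metis
  qed
  have none: "\<X> = ?\<sigma> ` \<C>" if sh: "shift_family i j \<X> = \<C>" and "M \<inter> \<X> = {}" for \<X>
  proof -
    have "?\<sigma> ` \<C> \<subseteq> \<X>" using basic[OF sh] that(2) by blast
    moreover have "card \<X> = card (?\<sigma> ` \<C>)"
      using card_shift_family[of i j \<X>] sh card_image[OF inj_swap_set] by simp
    moreover have "finite \<X>" using bij_betw_finite[OF bij_betw_shift_map[of i j \<X>]] sh fin by simp
    ultimately show ?thesis using card_subset_eq by metis
  qed
  have step: "G \<in> \<Y>" if "shift_family i j \<X> = \<C>" "shift_family i j \<Y> = \<C>" "cross_t_intersecting t \<X> \<Y>"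
    "F \<in> M" "G \<in> M" "card (F \<inter> ?\<sigma> G) < t" "F \<in> \<X>" for F G \<X> \<Y>
  proof -
    have "?\<sigma> G \<notin> \<Y>" using that(3,6,7) unfolding cross_t_intersecting_def by (metis not_le)
    then show ?thesis using basic[OF that(2), of G] that(5) by blast
  qed
  have cr': "cross_t_intersecting t \<B> \<A>" using cr cross_commute by blast
  have sym: "card (F \<inter> ?\<sigma> H) < t \<Longrightarrow> card (H \<inter> ?\<sigma> F) < t" for F H
    using card_swap_Int_left[of i j F H] by (simp add: Int_commute)
  \<comment> \<open>A choice in one family forces the same choice at a neighbour in the other, and
    two such steps return to the first family. Common neighbours thus carry one choice to all of
    \<open>M\<close>.\<close>
  have spread: "M \<subseteq> \<X> \<and> M \<subseteq> \<Y>" if sh: "shift_family i j \<X> = \<C>" "shift_family i j \<Y> = \<C>"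
    "cross_t_intersecting t \<X> \<Y>" "cross_t_intersecting t \<Y> \<X>" and F: "F \<in> M" "F \<in> \<X>" for F \<X> \<Y>
  proof -
    have X: "G \<in> \<X>" if G: "G \<in> M" for G
    proof -
      obtain H where H: "H \<in> M" "card (F \<inter> ?\<sigma> H) < t" "card (G \<inter> ?\<sigma> H) < t"
        using conn' F(1) G by blast
      have "H \<in> \<Y>" by (rule step[OF sh(1,2,3) F(1) H(1,2) F(2)])
      then show ?thesis using step[OF sh(2,1,4) H(1) G sym[OF H(3)]] by blast
    qed
    have "G \<in> \<Y>" if G: "G \<in> M" for G
    proof -
      obtain H where H: "H \<in> M" "card (G \<inter> ?\<sigma> H) < t" using conn' G by blast
      show ?thesis by (rule step[OF sh(1,2,3) H(1) G sym[OF H(2)] X[OF H(1)]])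
    qed
    then show ?thesis using X by blast
  qed
  show ?thesis
  proof (cases "M \<inter> \<A> = {} \<and> M \<inter> \<B> = {}")
    case True
    then show ?thesis using none[OF shA] none[OF shB] by simp
  next
    case False
    then have "M \<subseteq> \<A> \<and> M \<subseteq> \<B>" using spread[OF shA shB cr cr'] spread[OF shB shA cr' cr] by blast
    then show ?thesis using all[OF shA] all[OF shB] by simp
  qed
qed

lemma swap_star:
  assumes "i \<in> {1..n}" "j \<in> {1..n}"
  shows "swap_set i j ` star n k T = star n k (swap_set i j T)"
proof -
  have sub: "swap_set i j F \<in> star n k (swap_set i j T)" if "F \<in> star n k T" for F T
    using that swap_nsets[OF assms] by (auto simp: star_def mem_swap_set)
  show ?thesis
  proof (intro equalityI subsetI)
    fix F assume "F \<in> star n k (swap_set i j T)"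
    then have "swap_set i j F \<in> star n k T" using sub[of F "swap_set i j T"] by simp
    then show "F \<in> swap_set i j ` star n k T" by (metis imageI swap_swap)
  qed (use sub in auto)
qed

lemma swap_frankl:
  assumes "i \<in> {1..n}" "j \<in> {1..n}"
  shows "swap_set i j ` frankl n k t S = frankl n k t (swap_set i j S)"
proof -
  have sub: "swap_set i j F \<in> frankl n k t (swap_set i j S)" if "F \<in> frankl n k t S" for F S
    using that swap_nsets[OF assms] by (simp add: frankl_def card_swap_Int)
  show ?thesis
  proof (intro equalityI subsetI)
    fix F assume "F \<in> frankl n k t (swap_set i j S)"
    then have "swap_set i j F \<in> frankl n k t S" using sub[of F "swap_set i j S"] by simp
    then show "F \<in> swap_set i j ` frankl n k t S" by (metis imageI swap_swap)
  qed (use sub in auto)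
qed

lemma extremal_swap:
  assumes "i \<in> {1..n}" "j \<in> {1..n}" "extremal n k t \<F>"
  shows "extremal n k t (swap_set i j ` \<F>)"
  using assms(3) swap_star[OF assms(1,2)] swap_frankl[OF assms(1,2)]
    swap_set_subset[OF assms(1,2)] card_swap_set
  unfolding extremal_def by metis

lemma obtain_avoiding:
  assumes "finite W" "card W + m \<le> n"
  obtains D where "D \<subseteq> {1..n::nat}" "D \<inter> W = {}" "card D = m" "finite D"
proof -
  have "n - card W \<le> card ({1..n} - W)" using diff_card_le_card_Diff[OF assms(1), of "{1..n}"] by simp
  then have "m \<le> card ({1..n} - W)" using assms by linarith
  then obtain D where "D \<subseteq> {1..n} - W" "card D = m" "finite D" by (rule obtain_subset_with_card_n)
  then show ?thesis using that by blast
qed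

section \<open>Undoing shifts\<close>

lemma starD: "F \<in> star n k T \<Longrightarrow> F \<in> nsets {1..n} k \<and> F \<subseteq> {1..n} \<and> card F = k \<and> finite F \<and> T \<subseteq> F"
  using nsets_nat_iff[of F n k] by (auto simp: star_def nsets_def)

lemma frankl_D:
  "F \<in> frankl n k t S \<Longrightarrow> F \<in> nsets {1..n} k \<and> F \<subseteq> {1..n} \<and> card F = k \<and> finite F \<and> t + 1 \<le> card (F \<inter> S)"
  using nsets_nat_iff[of F n k] by (auto simp: frankl_def nsets_def)

lemma card_Un_Diffs_le: "card (S \<union> F \<union> G) \<le> card S + card (F - S) + card (G - S)"
proof -
  have "S \<union> F \<union> G = S \<union> (F - S) \<union> (G - S)" by auto
  then show ?thesis using card_Un_le[of "S \<union> (F - S)" "G - S"] card_Un_le[of S "F - S"] by simp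
qed

text \<open>A member leaves the star under the swap only if i is in \<open>T\<close> and j is
  outside it. Take H = T + D with D avoiding T, F, G and j: its swap meets F and G inside
  \<open>T - {i}\<close>. Finding D needs t + 2 (k - t) + 1 occupied and k - t further points, hence
  the bound on n.\<close>

lemma star_connected:
  assumes n: "3 * (k - t) + t + 1 \<le> n" and tk: "t \<le> k"
    and ij: "i \<in> {1..n}" "j \<in> {1..n}"
    and T: "T \<subseteq> {1..n}" "card T = t"
    and F: "F \<in> star n k T" "i \<in> F" "swap_set i j F \<notin> star n k T"
    and G: "G \<in> star n k T" "i \<in> G" "swap_set i j G \<notin> star n k T"
  shows "\<exists>H\<in>star n k T. i \<in> H \<and> swap_set i j H \<notin> star n k T \<and>
          card (F \<inter> swap_set i j H) < t \<and> card (G \<inter> swap_set i j H) < t"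
proof -
  have fT: "finite T" using T finite_subset by auto
  note FD = starD[OF F(1)] and GD = starD[OF G(1)]
  have jF: "j \<notin> F" and jG: "j \<notin> G" using F G swap_set_same[of i F j] swap_set_same[of i G j] by metis+
  have iT: "i \<in> T"
  proof (rule ccontr)
    assume "i \<notin> T"
    then have "T \<subseteq> swap_set i j F" using swap_set_up[OF F(2) jF] FD by auto
    then show False using F(3) swap_nsets[OF ij, of F k] FD by (simp add: star_def)
  qed
  have jT: "j \<notin> T" using jF FD by auto
  let ?W = "insert j (T \<union> F \<union> G)"
  have "card (F - T) = k - t" "card (G - T) = k - t" using FD GD T fT by (simp_all add: card_Diff_subset)
  then have "card ?W \<le> Suc (t + (k - t) + (k - t))"
    using card_Un_Diffs_le[of T F G] card_insert_le_m1[of _ "T \<union> F \<union> G" j] T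
      card_insert_if[of "T \<union> F \<union> G" j] fT FD GD by (simp split: if_splits)
  then have "card ?W + (k - t) \<le> n" using n by linarith
  then obtain D where D: "D \<subseteq> {1..n}" "D \<inter> ?W = {}" "card D = k - t" "finite D"
    using obtain_avoiding[of ?W "k - t" n] fT FD GD by blast
  define H where "H = T \<union> D"
  have "T \<inter> D = {}" using D by blast
  then have "card H = k" using D fT T tk card_Un_disjoint[of T D] by (simp add: H_def)
  moreover have "H \<subseteq> {1..n}" using T D by (simp add: H_def)
  ultimately have HC: "H \<in> star n k T" using nsets_nat_iff[of H n k] by (simp add: H_def star_def)
  have jH: "j \<notin> H" and iH: "i \<in> H" using jT D iT by (auto simp: H_def)
  have sH: "swap_set i j H = insert j (H - {i})" using swap_set_up[OF iH jH] .
  have "i \<noteq> j" using iT jT by auto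
  then have "swap_set i j H \<notin> star n k T" using sH iT by (auto simp: star_def)
  moreover have lt: "card (X \<inter> swap_set i j H) < t" if "X \<inter> D = {}" "j \<notin> X" for X
  proof -
    have "X \<inter> swap_set i j H \<subseteq> T - {i}" using that unfolding sH unfolding H_def by auto
    then have "card (X \<inter> swap_set i j H) \<le> card (T - {i})" using fT by (intro card_mono) auto
    also have "\<dots> < t" using card_Diff1_less[OF fT iT] T by simp
    finally show ?thesis .
  qed
  moreover have "F \<inter> D = {}" "G \<inter> D = {}" using D by auto
  ultimately show ?thesis using HC iH jF jG by blast
qed

text \<open>A member leaving the family under the swap has i in \<open>S\<close>, j outside it, and
  trace \<open>S - {u}\<close> with u \<noteq> i. If F and G omit u and v, let H omit a fourth point
  w of \<open>S\<close> and be otherwise disjoint from F and G: the swap of H then meets F within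
  \<open>S - {w, i, u}\<close>, of size t - 1, and likewise G. Such a w exists because t + 2 >
  3.\<close>

lemma frankl_connected:
  assumes n: "3 * (k - t) + t \<le> n" and tk: "t < k" and t2: "2 \<le> t"
    and ij: "i \<in> {1..n}" "j \<in> {1..n}"
    and S: "S \<subseteq> {1..n}" "card S = t + 2"
    and F: "F \<in> frankl n k t S" "i \<in> F" "swap_set i j F \<notin> frankl n k t S"
    and G: "G \<in> frankl n k t S" "i \<in> G" "swap_set i j G \<notin> frankl n k t S"
  shows "\<exists>H\<in>frankl n k t S. i \<in> H \<and> swap_set i j H \<notin> frankl n k t S \<and>
          card (F \<inter> swap_set i j H) < t \<and> card (G \<inter> swap_set i j H) < t"
proof -
  have fS: "finite S" using S finite_subset by auto
  have undetermined: "j \<notin> X \<and> i \<in> S \<and> j \<notin> S \<and> card (X \<inter> S) = t + 1 \<and> (\<exists>u\<in>S - {i}. X \<inter> S = S - {u})"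
    if X: "X \<in> frankl n k t S" "i \<in> X" "swap_set i j X \<notin> frankl n k t S" for X
  proof -
    note XD = frankl_D[OF X(1)]
    have jX: "j \<notin> X" using X swap_set_same[of i X j] by metis
    note sX = swap_set_up[OF X(2) jX]
    have lt: "card (swap_set i j X \<inter> S) < t + 1"
      using X(3) swap_nsets[OF ij, of X k] XD by (simp add: frankl_def)
    have iS: "i \<in> S"
    proof (rule ccontr)
      assume "i \<notin> S"
      then have "X \<inter> S \<subseteq> swap_set i j X \<inter> S" unfolding sX by auto
      then have "card (X \<inter> S) \<le> card (swap_set i j X \<inter> S)" using fS by (intro card_mono) auto
      then show False using XD lt by simp
    qed
    have jS: "j \<notin> S"
    proof
      assume "j \<in> S"
      then have "swap_set i j X \<inter> S = insert j ((X \<inter> S) - {i})" unfolding sX by auto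
      moreover have "card (insert j ((X \<inter> S) - {i})) = card (X \<inter> S)"
        using X iS jX fS by (intro card_swap) auto
      ultimately show False using lt XD by simp
    qed
    have "swap_set i j X \<inter> S = (X \<inter> S) - {i}" using jS unfolding sX by auto
    then have "card (X \<inter> S) - 1 < t + 1" using lt X iS fS by simp
    moreover have "card (X \<inter> S) \<le> t + 2" using card_mono[of S "X \<inter> S"] S fS by simp
    moreover have "card (S - X) = t + 2 - card (X \<inter> S)"
      using card_Diff_subset_Int[of S X] fS S by (simp add: Int_commute)
    ultimately have c: "card (X \<inter> S) = t + 1" "card (S - X) = 1" using XD by linarith+
    then obtain u where "S - X = {u}" by (auto simp: card_1_singleton_iff)
    then have "u \<in> S - {i}" "X \<inter> S = S - {u}" using X by auto
    then show ?thesis using c jX iS jS by blast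
  qed
  note FA = undetermined[OF F] and GA = undetermined[OF G]
  note FD = frankl_D[OF F(1)] and GD = frankl_D[OF G(1)]
  obtain u v where u: "u \<in> S" "u \<noteq> i" "F \<inter> S = S - {u}" and v: "v \<in> S" "v \<noteq> i" "G \<inter> S = S - {v}"
    using FA GA by blast
  have iS: "i \<in> S" and jS: "j \<notin> S" and jF: "j \<notin> F" and jG: "j \<notin> G" using FA GA by auto
  have "card {i, u, v} \<le> 3" by (simp add: card_insert_if)
  then have "card {i, u, v} < card S" using S t2 by simp
  then have "\<not> S \<subseteq> {i, u, v}" using card_mono[of "{i, u, v}" S] by auto
  then obtain w where w: "w \<in> S" "w \<noteq> i" "w \<noteq> u" "w \<noteq> v" by auto
  let ?W = "insert j (S \<union> F \<union> G)"
  have "card (F - S) = k - (t + 1)" "card (G - S) = k - (t + 1)"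
    using card_Diff_subset_Int[of F S] card_Diff_subset_Int[of G S] FA GA FD GD fS by simp_all
  then have "card ?W \<le> Suc (t + 2 + (k - (t + 1)) + (k - (t + 1)))"
    using card_Un_Diffs_le[of S F G] S card_insert_if[of "S \<union> F \<union> G" j] fS FD GD
    by (simp split: if_splits)
  then have "card ?W + (k - (t + 1)) \<le> n" using n tk by linarith
  then obtain D where D: "D \<subseteq> {1..n}" "D \<inter> ?W = {}" "card D = k - (t + 1)" "finite D"
    using obtain_avoiding[of ?W "k - (t + 1)" n] fS FD GD by blast
  define H where "H = (S - {w}) \<union> D"
  have "(S - {w}) \<inter> D = {}" using D by blast
  moreover have cw: "card (S - {w}) = t + 1" using S w fS by simp
  ultimately have "card H = k" using D fS tk card_Un_disjoint[of "S - {w}" D] by (simp add: H_def)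
  moreover have "H \<subseteq> {1..n}" using S D by (auto simp: H_def)
  ultimately have HN: "H \<in> nsets {1..n} k" using nsets_nat_iff[of H n k] by simp
  have HS: "H \<inter> S = S - {w}" using D by (auto simp: H_def)
  then have HC: "H \<in> frankl n k t S" using HN cw by (simp add: frankl_def)
  have jH: "j \<notin> H" and iH: "i \<in> H" using jS D iS w by (auto simp: H_def)
  have sH: "swap_set i j H = insert j (H - {i})" using swap_set_up[OF iH jH] .
  have "swap_set i j H \<inter> S = (S - {w}) - {i}" using sH HS jS by auto
  moreover have "card ((S - {w}) - {i}) = t" using cw iS w fS by simp
  ultimately have "swap_set i j H \<notin> frankl n k t S" by (simp add: frankl_def)
  moreover have "card (X \<inter> swap_set i j H) < t"
    if "X \<inter> D = {}" "j \<notin> X" "x \<in> S" "x \<noteq> i" "x \<noteq> w" "X \<inter> S = S - {x}" for X x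
  proof -
    have "X \<inter> swap_set i j H \<subseteq> ((S - {w}) - {i}) - {x}" using that unfolding sH unfolding H_def by auto
    then have "card (X \<inter> swap_set i j H) \<le> card (((S - {w}) - {i}) - {x})"
      using fS by (intro card_mono) auto
    also have "\<dots> < card ((S - {w}) - {i})" using that fS by (intro card_Diff1_less) auto
    finally show ?thesis using \<open>card ((S - {w}) - {i}) = t\<close> by simp
  qed
  moreover have "F \<inter> D = {}" "G \<inter> D = {}" using D by auto
  ultimately show ?thesis using HC iH jF jG u v w by metis
qed

section \<open>Reduction of arbitrary maximal pairs to shifted ones\<close>

lemma level_small_sets:
  assumes "\<X> \<subseteq> small_sets n k"
  shows "level k \<X> \<subseteq> nsets {1..n} k"
  using assms nsets_nat_iff[of _ n k] by (auto simp: level_def small_sets_def)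

text \<open>Closing under \<open>perp\<close> can only enlarge both families at level k and keeps
  them cross-intersecting, so a pair of maximal positive product is already closed there.\<close>

lemma max_cross_pair_shifted:
  assumes t3: "3 \<le> t" and tk: "t \<le> k" and n: "n \<ge> (t + 1) * (k - t + 1)"
    and mx: "max_cross_pair n k t \<A> \<B>" and sh: "shifted \<A>" "shifted \<B>"
    and pos: "0 < card \<A> * card \<B>"
  shows "\<A> = \<B> \<and> extremal n k t \<A>"
proof -
  have AB: "\<A> \<subseteq> nsets {1..n} k" "\<B> \<subseteq> nsets {1..n} k" and cr: "cross_t_intersecting t \<A> \<B>"
    using mx by (auto simp: max_cross_pair_def)
  have small: "\<A> \<subseteq> small_sets n k" "\<B> \<subseteq> small_sets n k"
    using AB nsets_nat_iff[of _ n k] by (auto simp: small_sets_def)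
  define V U where "V = perp n k t \<A>" and "U = perp n k t V"
  have VU: "V = perp n k t U" unfolding U_def V_def using perp_perp_perp[OF small(1)] by simp
  have UVs: "U \<subseteq> small_sets n k" "V \<subseteq> small_sets n k" by (auto simp: U_def V_def perp_def)
  have fin: "finite F" if "F \<in> small_sets n k" for F
    using that finite_subset by (auto simp: small_sets_def)
  have shV: "shifted V" unfolding V_def using sh(1) fin small by (intro shifted_perp) auto
  have shU: "shifted U" unfolding U_def using shV fin UVs by (intro shifted_perp) auto
  have AU: "\<A> \<subseteq> U" unfolding U_def V_def by (rule subset_perp_perp[OF small(1)])
  have BV: "\<B> \<subseteq> V"
  proof
    fix G assume G: "G \<in> \<B>"
    have "t \<le> card (G \<inter> F)" if "F \<in> \<A>" for F
      using cr that G by (subst Int_commute) (simp add: cross_t_intersecting_def)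
    then show "G \<in> V" using G small(2) by (auto simp: V_def perp_def)
  qed
  have AL: "\<A> \<subseteq> level k U" "\<B> \<subseteq> level k V"
    using AU BV AB nsets_nat_iff[of _ n k] by (auto simp: level_def)
  have LN: "level k U \<subseteq> nsets {1..n} k" "level k V \<subseteq> nsets {1..n} k"
    using level_small_sets UVs by auto
  have fL: "finite (level k U)" "finite (level k V)"
    using LN finite_nsets_nat finite_subset by metis+
  have "cross_t_intersecting t (level k U) (level k V)"
    unfolding cross_t_intersecting_def level_def U_def using perp_cross by blast
  then have "card (level k U) * card (level k V) \<le> card \<A> * card \<B>"
    using mx LN by (auto simp: max_cross_pair_def)
  then have "card \<A> = card (level k U) \<and> card \<B> = card (level k V)"
    using card_mono[OF fL(1) AL(1)] card_mono[OF fL(2) AL(2)] pos by (intro factors_eq_of_mult_ge)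
  then have eq: "\<A> = level k U" "\<B> = level k V"
    using AL fL card_subset_eq by metis+
  interpret dual_pair n k t U V
    by unfold_locales (use t3 tk n VU shU shV mx eq in \<open>auto simp: U_def\<close>)
  show ?thesis unfolding eq by (rule level_extremal)
qed

lemma max_cross_pair_shift:
  assumes mx: "max_cross_pair n k t \<A> \<B>" and ij: "i \<in> {1..n}" "j \<in> {1..n}"
  shows "max_cross_pair n k t (shift_family i j \<A>) (shift_family i j \<B>)"
proof -
  have AB: "\<A> \<subseteq> nsets {1..n} k" "\<B> \<subseteq> nsets {1..n} k" and cr: "cross_t_intersecting t \<A> \<B>"
    using mx by (auto simp: max_cross_pair_def)
  have "finite F" if "F \<in> \<A> \<union> \<B>" for F using that AB by (auto simp: nsets_def)
  then have "cross_t_intersecting t (shift_family i j \<A>) (shift_family i j \<B>)"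
    by (rule cross_shift_family[OF cr])
  then show ?thesis
    using mx shift_family_subset[OF ij AB(1)] shift_family_subset[OF ij AB(2)]
    by (simp add: max_cross_pair_def card_shift_family)
qed

lemma unshift_extremal:
  assumes t3: "3 \<le> t" and tk: "t \<le> k" and n: "n \<ge> (t + 1) * (k - t + 1)"
    and ij: "i \<in> {1..n}" "j \<in> {1..n}" and cr: "cross_t_intersecting t \<A> \<B>"
    and eq: "shift_family i j \<A> = \<C>" "shift_family i j \<B> = \<C>" and ex: "extremal n k t \<C>"
  shows "\<A> = \<B> \<and> extremal n k t \<A>"
proof -
  obtain s where k: "k = t + s" using tk le_Suc_ex by blast
  have "t * s + t + s + 1 \<le> n" using n k by (simp add: algebra_simps)
  \<comment> \<open>The room demanded by the connectivity lemmas; it comes from t \<ge> 3.\<close>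
  then have "3 * s + t + 1 \<le> n" using mult_le_mono1[OF t3, of s] by linarith
  then have n': "3 * (k - t) + t + 1 \<le> n" using k by simp
  have "\<A> = \<B> \<and> (\<A> = \<C> \<or> \<A> = swap_set i j ` \<C>)"
    using ex unfolding extremal_def
  proof (elim disjE exE conjE)
    fix T assume T: "T \<subseteq> {1..n}" "card T = t" "\<C> = star n k T"
    show ?thesis
      by (rule unshift[OF eq _ cr]; unfold T(3))
        (rule finite_star, rule star_connected[OF n' tk ij T(1,2)])
  next
    fix S assume S: "t < k" "S \<subseteq> {1..n}" "card S = t + 2" "\<C> = frankl n k t S"
    have "3 * (k - t) + t \<le> n" "2 \<le> t" using n' t3 by auto
    note conn = frankl_connected[OF this(1) S(1) this(2) ij S(2,3)]
    show ?thesis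
      by (rule unshift[OF eq _ cr]; unfold S(4)) (rule finite_frankl, rule conn)
  qed
  then show ?thesis using ex extremal_swap[OF ij ex] by auto
qed

text \<open>The same shift is applied to both families, which keeps the pair maximal. By induction
  the shifted families coincide in one extremal family, exactly what \<open>unshift_extremal\<close>
  takes as input.\<close>

lemma max_cross_pair_extremal:
  assumes t3: "3 \<le> t" and tk: "t \<le> k" and n: "n \<ge> (t + 1) * (k - t + 1)"
    and "max_cross_pair n k t \<A> \<B>" and "0 < card \<A> * card \<B>"
  shows "\<A> = \<B> \<and> extremal n k t \<A>"
  using assms(4,5)
proof (induction "weight \<A> + weight \<B>" arbitrary: \<A> \<B> rule: less_induct)
  case less
  have AB: "\<A> \<subseteq> nsets {1..n} k" "\<B> \<subseteq> nsets {1..n} k" and cr: "cross_t_intersecting t \<A> \<B>"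
    using less.prems by (auto simp: max_cross_pair_def)
  have fin: "finite \<A>" "finite \<B>" using AB finite_nsets_nat finite_subset by metis+
  have fin': "\<And>F. F \<in> \<A> \<Longrightarrow> finite F" "\<And>F. F \<in> \<B> \<Longrightarrow> finite F" using AB by (auto simp: nsets_def)
  show ?case
  proof (cases "\<exists>i j. 1 \<le> i \<and> i < j \<and> j \<le> n \<and> (shift_family i j \<A> \<noteq> \<A> \<or> shift_family i j \<B> \<noteq> \<B>)")
    case True
    then obtain i j where ij: "1 \<le> i" "i < j" "j \<le> n"
      and ne: "shift_family i j \<A> \<noteq> \<A> \<or> shift_family i j \<B> \<noteq> \<B>" by blast
    have ijn: "i \<in> {1..n}" "j \<in> {1..n}" using ij by auto
    have lt: "weight (shift_family i j \<A>) + weight (shift_family i j \<B>) < weight \<A> + weight \<B>"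
      using weight_shift_family[OF ij(2) fin(1) fin'(1)] weight_shift_family[OF ij(2) fin(2) fin'(2)] ne
      by linarith
    have "0 < card (shift_family i j \<A>) * card (shift_family i j \<B>)"
      using less.prems(2) by (simp add: card_shift_family)
    then have "shift_family i j \<A> = shift_family i j \<B> \<and> extremal n k t (shift_family i j \<A>)"
      by (rule less.hyps[OF lt max_cross_pair_shift[OF less.prems(1) ijn]])
    then show ?thesis using unshift_extremal[OF t3 tk n ijn cr] by metis
  next
    case False
    then have "shifted \<A>" "shifted \<B>"
      using shifted_of_fixed[OF AB(1)] shifted_of_fixed[OF AB(2)] by blast+
    then show ?thesis using max_cross_pair_shifted[OF t3 tk n less.prems(1) _ _ less.prems(2)] by blast
  qed
qed

section \<open>The bound and its equality case\<close>

theorem theorem1p6: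
  fixes n k t :: nat and \<A> \<B> :: "nat set set"
  assumes "3 \<le> t" and "t \<le> k" and "k \<le> n"
    and "n \<ge> (t + 1) * (k - t + 1)"
    and "\<A> \<subseteq> nsets {1..n} k" and "\<B> \<subseteq> nsets {1..n} k"
    and "cross_t_intersecting t \<A> \<B>"
  shows "card \<A> * card \<B> \<le> ((n - t) choose (k - t))\<^sup>2 \<and>
    (card \<A> * card \<B> = ((n - t) choose (k - t))\<^sup>2 \<longleftrightarrow>
      \<A> = \<B> \<and> maximum_t_intersecting t (nsets {1..n} k) \<A>)"
proof -
  let ?M = "(n - t) choose (k - t)" and ?N = "nsets {1..n} k" and ?S = "star n k {1..t}"
  have M0: "0 < ?M" using assms(2,3) by simp
  have S: "?S \<subseteq> ?N" "card ?S = ?M" "cross_t_intersecting t ?S ?S"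
    using card_star[of "{1..t}" n t k] cross_star[of "{1..t}" t n k] assms(2,3) starD by auto
  define P where "P = {(\<X>, \<Y>). \<X> \<subseteq> ?N \<and> \<Y> \<subseteq> ?N \<and> cross_t_intersecting t \<X> \<Y>}"
  define f where "f = (\<lambda>p::nat set set \<times> nat set set. card (fst p) * card (snd p))"
  have finP: "finite P"
    by (rule finite_subset[of _ "Pow ?N \<times> Pow ?N"]) (auto simp: P_def finite_nsets_nat[simplified])
  have SP: "(?S, ?S) \<in> P" using S by (simp add: P_def)
  have "Max (f ` P) \<in> f ` P" using finP SP by (intro Max_in) auto
  then obtain p where p: "p \<in> P" "f p = Max (f ` P)" by (metis imageE)
  have top: "f q \<le> f p" if "q \<in> P" for q unfolding p(2) using finP that by (intro Max_ge) auto
  have mxp: "max_cross_pair n k t \<X> \<Y>" if "(\<X>, \<Y>) \<in> P" "f (\<X>, \<Y>) = f p" for \<X> \<Y>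
    unfolding max_cross_pair_def using that top by (auto simp: P_def f_def)
  have "?M\<^sup>2 \<le> f p" using top[OF SP] S by (simp add: f_def power2_eq_square)
  \<comment> \<open>Used twice: for the pair \<open>p\<close>, to evaluate the maximum, and later
    for a given pair attaining it. Comparison with the star supplies the positivity
    required.\<close>
  have extr: "\<X> = \<Y> \<and> extremal n k t \<X>" if "(\<X>, \<Y>) \<in> P" "f (\<X>, \<Y>) = f p" for \<X> \<Y>
  proof (rule max_cross_pair_extremal[OF assms(1,2,4) mxp[OF that]])
    show "0 < card \<X> * card \<Y>"
      using that(2) \<open>?M\<^sup>2 \<le> f p\<close> M0 less_le_trans[of 0 "?M\<^sup>2" "f p"] by (simp add: f_def)
  qed
  obtain \<X> \<Y> where pXY: "p = (\<X>, \<Y>)" by (cases p)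
  then have XY: "\<X> = \<Y>" "extremal n k t \<X>" using extr[of \<X> \<Y>] p by auto
  have "card \<X> \<le> ?M"
    using XY(2) unfolding extremal_def
    by (metis assms(2,4) card_star frankl_le_star order_refl)
  then have "f p \<le> ?M\<^sup>2" using pXY XY(1) by (simp add: f_def power2_eq_square mult_le_mono)
  then have fp: "f p = ?M\<^sup>2" using \<open>?M\<^sup>2 \<le> f p\<close> by simp
  have bound: "card \<X> * card \<Y> \<le> ?M\<^sup>2"
    if "\<X> \<subseteq> ?N" "\<Y> \<subseteq> ?N" "cross_t_intersecting t \<X> \<Y>" for \<X> \<Y>
    using top[of "(\<X>, \<Y>)"] that fp by (simp add: P_def f_def)
  have self: "card \<X> \<le> ?M" if "\<X> \<subseteq> ?N" "t_intersecting t \<X>" for \<X>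
  proof -
    have "(card \<X>)\<^sup>2 \<le> ?M\<^sup>2"
      using bound[of \<X> \<X>] that by (simp add: t_intersecting_def cross_t_intersecting_def power2_eq_square)
    then show ?thesis by simp
  qed
  have "card \<A> * card \<B> = ?M\<^sup>2 \<longleftrightarrow> \<A> = \<B> \<and> maximum_t_intersecting t ?N \<A>"
  proof
    assume eq: "card \<A> * card \<B> = ?M\<^sup>2"
    then have AB: "\<A> = \<B>" using extr[of \<A> \<B>] assms fp by (simp add: P_def f_def)
    then have "card \<A> = ?M" using eq by (simp flip: power2_eq_square)
    then show "\<A> = \<B> \<and> maximum_t_intersecting t ?N \<A>"
      using AB assms(5,7) self
      by (auto simp: maximum_t_intersecting_def t_intersecting_def cross_t_intersecting_def)
  next
    assume r: "\<A> = \<B> \<and> maximum_t_intersecting t ?N \<A>"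
    have "t_intersecting t ?S" using S(3) by (simp add: t_intersecting_def cross_t_intersecting_def)
    then have "?M \<le> card \<A>" using r S by (auto simp: maximum_t_intersecting_def)
    moreover have "card \<A> \<le> ?M" using r self by (auto simp: maximum_t_intersecting_def)
    ultimately show "card \<A> * card \<B> = ?M\<^sup>2" using r by (simp add: power2_eq_square)
  qed
  then show ?thesis using bound[OF assms(5-7)] by blast
qed

end
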